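(* Let $f:\{0,1\}^n\times\{0,1\}^n\to\{0,1\}$ be a Boolean function and let $G$ be a garden-hose game of size $s$ that computes $f$. Then there is a perfect attack on the one-qubit position-verification protocol associated with $f$ in which the two adversaries pre-share $s$ EPR pairs and use one round of simultaneous classical communication. In particular, $GH(f)$ EPR pairs suffice for a perfect attack.
   Context: Garden-hose game of size $s\in\mathbb{N}$: let $A=\{1^A,\dots,s^A\}$, $B=\{1^B,\dots,s^B\}$, $A_\circ=A\cup\{0\}$, and $E=\{\{i^A,i^B\}:1\le i\le s\}$ (the pipes). A game $G$ is given by functions $E_{A_\circ},E_B$ on $\{0,1\}^n$, where $E_{A_\circ}(x)$ is a set of edges (no self-loops) on $A_\circ$ and $E_B(y)$ is a set of edges (no self-loops) on $B$, such that the graphs $(A_\circ,E_{A_\circ}(x))$ and $(B,E_B(y))$ have maximum degree at most $1$. Put $G(x,y)=(A_\circ\cup B,\,E\cup E_{A_\circ}(x)\cup E_B(y))$. There is a unique maximal path $\pi(x,y)$ in $G(x,y)$ starting at $0$. $G$ computes $f$ if for all $x,y$ the endpoint of $\pi(x,y)$ lies in $A_\circ$ when $f(x,y)=0$ and in $B$ when $f(x,y)=1$. $GH(f)$ is the smallest size of a game computing $f$. EPR pair: $\frac1{\sqrt2}(\ket{00}+\ket{11})$, one qubit held by each adversary. Attack on the one-qubit protocol: Alice receives $x\in\{0,1\}^n$ and a qubit in an arbitrary unknown state $\ket\phi$ (possibly half of an EPR pair whose other half is kept by the verifiers); Bob receives $y\in\{0,1\}^n$. They pre-share an entangled state, each performs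 local quantum operations (depending on own input), then they simultaneously exchange one classical message each, and then perform further local quantum operations. The attack is perfect if for all $x,y$, with certainty, at the end Alice holds the qubit in state $\ket\phi$ (with its correlations to outside systems preserved) when $f(x,y)=0$ and Bob holds it when $f(x,y)=1$. *)

theory Defs
  imports "Jordan_Normal_Form.Schur_Decomposition"
begin

definition bitstrings :: "nat \<Rightarrow> bool list set" where
  "bitstrings n = {x. length x = n}"


subsection \<open>The garden-hose game\<close>

(* Tap is the vertex 0; PipeA i and PipeB i are the two ends of the i-th pipe. *)
datatype hose_vertex = Tap | PipeA nat | PipeB nat

definition verticesA :: "nat \<Rightarrow> hose_vertex set" where
  "verticesA s = PipeA ` {1..s}"

definition verticesA0 :: "nat \<Rightarrow> hose_vertex set" where
  "verticesA0 s = insert Tap (verticesA s)"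

definition verticesB :: "nat \<Rightarrow> hose_vertex set" where
  "verticesB s = PipeB ` {1..s}"

definition pipes :: "nat \<Rightarrow> hose_vertex set set" where
  "pipes s = {{PipeA i, PipeB i} | i. 1 \<le> i \<and> i \<le> s}"

record hose_game =
  num_pipes :: nat
  linksA :: "bool list \<Rightarrow> hose_vertex set set"
  linksB :: "bool list \<Rightarrow> hose_vertex set set"

definition graph_edges :: "'a set \<Rightarrow> 'a set set \<Rightarrow> bool" where
  "graph_edges V E \<longleftrightarrow> E \<subseteq> {{u, v} | u v. u \<in> V \<and> v \<in> V \<and> u \<noteq> v}"

definition degree_in :: "'a set set \<Rightarrow> 'a \<Rightarrow> nat" where
  "degree_in E v = card {e \<in> E. v \<in> e}"

definition garden_hose_game :: "nat \<Rightarrow> hose_game \<Rightarrow> bool" where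
  "garden_hose_game n G \<longleftrightarrow>
     (\<forall>x \<in> bitstrings n. graph_edges (verticesA0 (num_pipes G)) (linksA G x)
        \<and> (\<forall>v \<in> verticesA0 (num_pipes G). degree_in (linksA G x) v \<le> 1)) \<and>
     (\<forall>y \<in> bitstrings n. graph_edges (verticesB (num_pipes G)) (linksB G y)
        \<and> (\<forall>v \<in> verticesB (num_pipes G). degree_in (linksB G y) v \<le> 1))"

definition game_vertices :: "hose_game \<Rightarrow> hose_vertex set" where
  "game_vertices G = verticesA0 (num_pipes G) \<union> verticesB (num_pipes G)"

definition game_edges :: "hose_game \<Rightarrow> bool list \<Rightarrow> bool list \<Rightarrow> hose_vertex set set" where
  "game_edges G x y = pipes (num_pipes G) \<union> linksA G x \<union> linksB G y"

definition graph_path :: "'a set \<Rightarrow> 'a set set \<Rightarrow> 'a list \<Rightarrow> bool" where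
  "graph_path V E p \<longleftrightarrow> p \<noteq> [] \<and> distinct p \<and> set p \<subseteq> V \<and> successively (\<lambda>u v. {u, v} \<in> E) p"

definition maximal_path_from :: "'a set \<Rightarrow> 'a set set \<Rightarrow> 'a \<Rightarrow> 'a list \<Rightarrow> bool" where
  "maximal_path_from V E v p \<longleftrightarrow>
     graph_path V E p \<and> hd p = v \<and> (\<forall>q. q \<noteq> [] \<longrightarrow> \<not> graph_path V E (p @ q))"

lemma degree_le_1_unique:
  assumes E: "graph_edges V E" "finite V" and d: "degree_in E u \<le> 1"
    and e: "{u, v} \<in> E" "{u, w} \<in> E"
  shows "v = w \<and> v \<noteq> u"
proof -
  have fin: "finite E"
    using E finite_subset[of E "Pow V"] by (force simp: graph_edges_def)
  have "card {e \<in> E. u \<in> e} \<le> Suc 0" using d by (simp add: degree_in_def)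
  with fin e have eq: "{u, v} = {u, w}" by (auto simp: card_le_Suc0_iff_eq)
  obtain a b where "{u, v} = {a, b}" "a \<noteq> b" using E e(1) unfolding graph_edges_def by auto
  hence "v \<noteq> u" by (auto simp: doubleton_eq_iff)
  with eq show ?thesis by (auto simp: doubleton_eq_iff)
qed

lemma graph_path_butlast:
  "graph_path V E (p @ [v]) \<Longrightarrow> p \<noteq> [] \<Longrightarrow> graph_path V E p"
  by (auto simp: graph_path_def successively_append_iff)

(* At most one vertex extends a path from Tap, which makes water_path well defined. *)
lemma game_path_step_unique:
  assumes G: "garden_hose_game n G" and xy: "x \<in> bitstrings n" "y \<in> bitstrings n"
    and p: "graph_path (game_vertices G) (game_edges G x y) (p @ [v])"
      "graph_path (game_vertices G) (game_edges G x y) (p @ [w])"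
    and ne: "p \<noteq> []" "hd p = Tap"
  shows "v = w"
proof -
  let ?s = "num_pipes G"
  let ?u = "last p"
  have gA: "graph_edges (verticesA0 ?s) (linksA G x)"
    and dA: "\<And>v. v \<in> verticesA0 ?s \<Longrightarrow> degree_in (linksA G x) v \<le> 1"
    and gB: "graph_edges (verticesB ?s) (linksB G y)"
    and dB: "\<And>v. v \<in> verticesB ?s \<Longrightarrow> degree_in (linksB G y) v \<le> 1"
    using G xy by (auto simp: garden_hose_game_def)
  have fin: "finite (verticesA0 ?s)" "finite (verticesB ?s)"
    by (auto simp: verticesA0_def verticesA_def verticesB_def)
  have uA: "v = w" if "{u, v} \<in> linksA G x" "{u, w} \<in> linksA G x" for u v w
  proof -
    have "u \<in> verticesA0 ?s" using gA that(1) by (auto simp: graph_edges_def doubleton_eq_iff)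
    from degree_le_1_unique[OF gA fin(1) dA[OF this] that] show ?thesis by simp
  qed
  have uB: "v = w" if "{u, v} \<in> linksB G y" "{u, w} \<in> linksB G y" for u v w
  proof -
    have "u \<in> verticesB ?s" using gB that(1) by (auto simp: graph_edges_def doubleton_eq_iff)
    from degree_le_1_unique[OF gB fin(2) dB[OF this] that] show ?thesis by simp
  qed
  have uP: "v = w" if "{u, v} \<in> pipes ?s" "{u, w} \<in> pipes ?s" for u v w
    using that by (auto simp: pipes_def doubleton_eq_iff)
  have disj: "\<not> ({u, v} \<in> linksA G x \<and> {u, w} \<in> linksB G y)" for u v w
  proof
    assume "{u, v} \<in> linksA G x \<and> {u, w} \<in> linksB G y"
    hence "u \<in> verticesA0 ?s" "u \<in> verticesB ?s"
      using gA gB by (auto simp: graph_edges_def doubleton_eq_iff)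
    thus False by (auto simp: verticesA0_def verticesA_def verticesB_def)
  qed
  have ev: "{?u, v} \<in> game_edges G x y" "{?u, w} \<in> game_edges G x y"
    using p ne by (auto simp: graph_path_def successively_append_iff)
  show ?thesis
  proof (cases "butlast p = []")
    case True
    hence u: "?u = Tap" using ne by (cases p) (auto split: if_splits)
    have "{Tap, z} \<in> game_edges G x y \<Longrightarrow> {Tap, z} \<in> linksA G x" for z
      using gB by (auto simp: game_edges_def pipes_def doubleton_eq_iff graph_edges_def verticesB_def)
    with ev u uA show ?thesis by metis
  next
    case False
    define q where "q = butlast p"
    define t where "t = last q"
    have pq: "p = q @ [?u]" "q \<noteq> []" using ne False by (auto simp: q_def)
    have "distinct (p @ [v])" "distinct (p @ [w])" using p by (auto simp: graph_path_def)
    moreover have "t \<in> set p" using pq unfolding t_def by (metis UnI1 last_in_set set_append)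
    ultimately have tv: "t \<noteq> v" "t \<noteq> w" by auto
    have "successively (\<lambda>u v. {u, v} \<in> game_edges G x y) p"
      using p(1) ne by (auto simp: graph_path_def successively_append_iff)
    hence "{t, ?u} \<in> game_edges G x y"
      using pq(2) unfolding t_def by (subst (asm) pq(1)) (simp add: successively_append_iff)
    hence et: "{?u, t} \<in> game_edges G x y" by (simp add: insert_commute)
    show ?thesis
      using ev et tv uA[of ?u] uB[of ?u] uP[of ?u] disj[of ?u] unfolding game_edges_def Un_iff by blast
  qed
qed

lemma water_path_unique:
  assumes "garden_hose_game n G" "x \<in> bitstrings n" "y \<in> bitstrings n"
  shows "\<exists>!p. maximal_path_from (game_vertices G) (game_edges G x y) Tap p"
proof -
  let ?P = "\<lambda>p. graph_path (game_vertices G) (game_edges G x y) p \<and> hd p = Tap"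
  have fin: "finite (game_vertices G)"
    by (auto simp: game_vertices_def verticesA0_def verticesA_def verticesB_def)
  have P0: "?P [Tap]" by (auto simp: graph_path_def game_vertices_def verticesA0_def)
  have bound: "length p \<le> card (game_vertices G)" if "?P p" for p
    using that fin by (metis graph_path_def card_mono distinct_card)
  have "\<exists>p. ?P p \<and> (\<forall>q. ?P q \<longrightarrow> length q \<le> length p)"
    using P0 bound by (intro ex_has_greatest_nat[where k = "[Tap]" and b = "Suc (card (game_vertices G))"]) (simp_all add: less_Suc_eq_le)
  then obtain p where p: "?P p" and pmax: "\<And>q. ?P q \<Longrightarrow> length q \<le> length p"
    by metis
  have "\<not> graph_path (game_vertices G) (game_edges G x y) (p @ q)" if "q \<noteq> []" for q
  proof
    assume "graph_path (game_vertices G) (game_edges G x y) (p @ q)"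
    hence "?P (p @ q)" using p by (auto simp: graph_path_def)
    from pmax[OF this] that show False by simp
  qed
  with p have ex: "maximal_path_from (game_vertices G) (game_edges G x y) Tap p"
    by (simp add: maximal_path_from_def)
  have comparable: "?P q \<Longrightarrow> ?P q' \<Longrightarrow> (\<exists>z. q' = q @ z) \<or> (\<exists>z. q = q' @ z)" for q q'
  proof (induction q rule: rev_induct)
    case Nil
    thus ?case by (simp add: graph_path_def)
  next
    case (snoc v q)
    show ?case
    proof (cases "q = []")
      case True
      with snoc.prems show ?thesis by (cases q') (auto simp: graph_path_def)
    next
      case False
      hence Pq: "?P q" using snoc.prems(1) graph_path_butlast[of _ _ q v] by auto
      from snoc.IH[OF Pq snoc.prems(2)] show ?thesis
      proof
        assume "\<exists>z. q = q' @ z"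
        thus ?thesis by auto
      next
        assume "\<exists>z. q' = q @ z"
        then obtain z where z: "q' = q @ z" by auto
        show ?thesis
        proof (cases z)
          case Nil
          thus ?thesis using z by auto
        next
          case (Cons w zs)
          have "graph_path (game_vertices G) (game_edges G x y) (q @ [w])"
            using snoc.prems(2) False unfolding z Cons
            by (auto simp: graph_path_def successively_append_iff)
          from game_path_step_unique[OF assms _ this False, of v] snoc.prems(1) Pq
          have "v = w" by auto
          thus ?thesis using z Cons by auto
        qed
      qed
    qed
  qed
  show ?thesis
  proof (rule ex1I[of _ p])
    show "maximal_path_from (game_vertices G) (game_edges G x y) Tap p" by fact
    fix q assume q: "maximal_path_from (game_vertices G) (game_edges G x y) Tap q"
    from comparable[of q p] p q ex show "q = p" unfolding maximal_path_from_def by auto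
  qed
qed

definition water_path :: "hose_game \<Rightarrow> bool list \<Rightarrow> bool list \<Rightarrow> hose_vertex list" where
  "water_path G x y = (THE p. maximal_path_from (game_vertices G) (game_edges G x y) Tap p)"

definition computes :: "nat \<Rightarrow> hose_game \<Rightarrow> (bool list \<Rightarrow> bool list \<Rightarrow> bool) \<Rightarrow> bool" where
  "computes n G f \<longleftrightarrow> (\<forall>x \<in> bitstrings n. \<forall>y \<in> bitstrings n.
     (\<not> f x y \<longrightarrow> last (water_path G x y) \<in> verticesA0 (num_pipes G)) \<and>
     (f x y \<longrightarrow> last (water_path G x y) \<in> verticesB (num_pipes G)))"

definition GH :: "nat \<Rightarrow> (bool list \<Rightarrow> bool list \<Rightarrow> bool) \<Rightarrow> nat" where
  "GH n f = (LEAST s. \<exists>G. garden_hose_game n G \<and> num_pipes G = s \<and> computes n G f)"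


subsection \<open>Finite-dimensional quantum systems\<close>

(* Kronecker product: a basis index of the composite system is i * d + j, where d is the
   dimension of the second factor. *)
definition kron :: "complex mat \<Rightarrow> complex mat \<Rightarrow> complex mat" where
  "kron A B = mat (dim_row A * dim_row B) (dim_col A * dim_col B)
     (\<lambda>(i, j). A $$ (i div dim_row B, j div dim_col B) * B $$ (i mod dim_row B, j mod dim_col B))"

(* The order on the complex numbers is the one of Complex_Order: 0 \<le> z says that z is real and
   nonnegative, so the second conjunct is positive semidefiniteness (and implies Hermitian). *)
definition density_operator :: "nat \<Rightarrow> complex mat \<Rightarrow> bool" where
  "density_operator d \<rho> \<longleftrightarrow> \<rho> \<in> carrier_mat d d
     \<and> (\<forall>v \<in> carrier_vec d. 0 \<le> (\<rho> *\<^sub>v v) \<bullet>c v)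
     \<and> (\<Sum>i<d. \<rho> $$ (i, i)) = 1"

(* Partial trace over the middle factor of a system with factors of dimensions a, b, c. *)
definition partial_trace :: "nat \<Rightarrow> nat \<Rightarrow> nat \<Rightarrow> complex mat \<Rightarrow> complex mat" where
  "partial_trace a b c \<rho> = mat (a * c) (a * c) (\<lambda>(i, j). \<Sum>k<b.
     \<rho> $$ ((i div c * b + k) * c + i mod c, (j div c * b + k) * c + j mod c))"

(* A quantum instrument with M classical outcomes, input dimension d and output dimension e;
   I m lists the Kraus operators of the branch with outcome m. *)
definition instrument :: "nat \<Rightarrow> nat \<Rightarrow> nat \<Rightarrow> (nat \<Rightarrow> complex mat list) \<Rightarrow> bool" where
  "instrument d e M I \<longleftrightarrow> (\<forall>m<M. set (I m) \<subseteq> carrier_mat e d)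
     \<and> mat d d (\<lambda>ij. \<Sum>m<M. \<Sum>K\<leftarrow>I m. (mat_adjoint K * K) $$ ij) = 1\<^sub>m d"

definition channel :: "nat \<Rightarrow> nat \<Rightarrow> complex mat list \<Rightarrow> bool" where
  "channel d e Ks \<longleftrightarrow> instrument d e 1 (\<lambda>_. Ks)"

definition apply_kraus :: "nat \<Rightarrow> complex mat list \<Rightarrow> complex mat \<Rightarrow> complex mat" where
  "apply_kraus e Ks \<rho> = mat e e (\<lambda>ij. \<Sum>K\<leftarrow>Ks. (K * \<rho> * mat_adjoint K) $$ ij)"

definition epr_pair :: "complex vec" where
  "epr_pair = vec_of_list [1 / sqrt 2, 0, 0, 1 / sqrt 2]"

definition bit_of :: "nat \<Rightarrow> nat \<Rightarrow> nat" where
  "bit_of i a = a div 2 ^ i mod 2"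

(* The s-fold tensor power of the EPR pair, with the tensor factors reordered so that Alice's s
   qubits precede Bob's: index a * 2^s + b stands for Alice's bits of a and Bob's bits of b. *)
definition epr_vec :: "nat \<Rightarrow> complex vec" where
  "epr_vec s = vec (2 ^ s * 2 ^ s) (\<lambda>k.
     \<Prod>i<s. epr_pair $ (2 * bit_of i (k div 2 ^ s) + bit_of i (k mod 2 ^ s)))"

definition epr_state :: "nat \<Rightarrow> complex mat" where
  "epr_state s = mat (2 ^ s * 2 ^ s) (2 ^ s * 2 ^ s) (\<lambda>(i, j). epr_vec s $ i * cnj (epr_vec s $ j))"


subsection \<open>Attacks on the one-qubit protocol\<close>

(* Alice's laboratory first contains the unknown qubit followed by her share of the resource, Bob's
   only his share.  Outcomes of the first-round instruments are the messages; any outcome a player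
   keeps private is part of the memory (of dimension memA, memB).  The second-round operation of
   each player depends on the own input and on both messages and outputs one qubit. *)
record attack =
  resA :: nat
  resB :: nat
  shared :: "complex mat"
  memA :: nat
  memB :: nat
  msgsA :: nat
  msgsB :: nat
  firstA :: "bool list \<Rightarrow> nat \<Rightarrow> complex mat list"
  firstB :: "bool list \<Rightarrow> nat \<Rightarrow> complex mat list"
  secondA :: "bool list \<Rightarrow> nat \<Rightarrow> nat \<Rightarrow> complex mat list"
  secondB :: "bool list \<Rightarrow> nat \<Rightarrow> nat \<Rightarrow> complex mat list"

definition valid_attack :: "nat \<Rightarrow> attack \<Rightarrow> bool" where
  "valid_attack n P \<longleftrightarrow>
     density_operator (resA P * resB P) (shared P) \<and>
     (\<forall>x \<in> bitstrings n. instrument (2 * resA P) (memA P) (msgsA P) (firstA P x)) \<and>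
     (\<forall>y \<in> bitstrings n. instrument (resB P) (memB P) (msgsB P) (firstB P y)) \<and>
     (\<forall>a < msgsA P. \<forall>b < msgsB P.
        (\<forall>x \<in> bitstrings n. channel (memA P) 2 (secondA P x a b)) \<and>
        (\<forall>y \<in> bitstrings n. channel (memB P) 2 (secondB P y a b)))"

(* Kraus operators of two simultaneous local operations, extended by the identity on an outside
   system of dimension r. *)
definition joint_kraus :: "nat \<Rightarrow> complex mat list \<Rightarrow> complex mat list \<Rightarrow> complex mat list" where
  "joint_kraus r Ks Ls = [kron (1\<^sub>m r) (kron K L). K \<leftarrow> Ks, L \<leftarrow> Ls]"

(* \<rho> is the initial state of the outside system (dimension r) and the unknown qubit; the result is a
   state of outside system, Alice's output qubit and Bob's output qubit, in this order. *)
definition final_state ::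
    "attack \<Rightarrow> bool list \<Rightarrow> bool list \<Rightarrow> nat \<Rightarrow> complex mat \<Rightarrow> complex mat" where
  "final_state P x y r \<rho> = mat (r * (2 * 2)) (r * (2 * 2)) (\<lambda>ij.
     \<Sum>a < msgsA P. \<Sum>b < msgsB P.
       apply_kraus (r * (2 * 2)) (joint_kraus r (secondA P x a b) (secondB P y a b))
         (apply_kraus (r * (memA P * memB P)) (joint_kraus r (firstA P x a) (firstB P y b))
           (kron \<rho> (shared P))) $$ ij)"

definition perfect_attack :: "nat \<Rightarrow> (bool list \<Rightarrow> bool list \<Rightarrow> bool) \<Rightarrow> attack \<Rightarrow> bool" where
  "perfect_attack n f P \<longleftrightarrow> valid_attack n P \<and>
     (\<forall>x \<in> bitstrings n. \<forall>y \<in> bitstrings n. \<forall>r \<rho>. density_operator (r * 2) \<rho> \<longrightarrow>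
        (\<not> f x y \<longrightarrow> partial_trace (r * 2) 2 1 (final_state P x y r \<rho>) = \<rho>) \<and>
        (f x y \<longrightarrow> partial_trace r 2 2 (final_state P x y r \<rho>) = \<rho>))"

definition shares_epr_pairs :: "nat \<Rightarrow> attack \<Rightarrow> bool" where
  "shares_epr_pairs s P \<longleftrightarrow> resA P = 2 ^ s \<and> resB P = 2 ^ s \<and> shared P = epr_state s"

end

theory Submission
  imports Defs
begin

text \<open>Each player applies a uniformly random Pauli operator to every own qubit and then applies the
  Bell functional to every linked pair, so that the qubit entering the tap is teleported along the water path.
  Its Pauli error at the end of the path is the product of the errors along the path.

  Expand all branches in the computational basis. On a nonzero term, the bits agree across every pipe
  and, after adding the Pauli shifts, across every link, so the sum over the path telescopes and the bit
  at the end of the path is the bit of the unknown qubit plus the total shift. Flipping all bits along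
  the path is a bijection of the terms that changes the weight by the total phase. Hence after
  correction every branch acts on the unknown qubit as a scalar. These scalars need not be computed:
  completeness of the instruments forces their squared moduli to sum to 1.\<close>

section \<open>Kraus operators and instruments\<close>

text \<open>The random Pauli strings replace Bell measurements. The outcomes of a measurement would
  depend on the links, and so would the proof of its completeness. In contrast, the sum over all
  Pauli strings \<open>Q\<close> of \<open>Q^dagger R^dagger R Q\<close> is a multiple of the
  identity for every operator \<open>R\<close>, so completeness requires of the links only that
  \<open>R\<close> is nonzero. The price is that unlinked qubits, among them the one at the end of
  the path, also suffer Pauli errors; the messages announce these too, and they join the total
  error. The correction depends on the whole path and hence on both inputs, which no player knows in
  the first round. This is why the inputs are sent along with the outcomes. Outside systems are
  treated by working with matrix entries: an outside index is only a label of a block on which each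
  branch acts in the same way. The claim about \<open>GH\<close> needs one more fact, that every
  function is computed by some game.\<close>

lemma sum_lessThan_mult_split:
  fixes f :: "nat \<Rightarrow> 'a :: comm_monoid_add"
  shows "sum f {..<a * b} = (\<Sum>i<a. \<Sum>j<b. f (i * b + j))"
proof -
  have "sum f {i * b..<i * b + b} = (\<Sum>j<b. f (i * b + j))" for i
    by (rule sum.reindex_bij_witness[of _ "\<lambda>j. i * b + j" "\<lambda>k. k - i * b"]) auto
  thus ?thesis by (simp flip: sum.nat_group)
qed

lemma mult_add_less:
  fixes i j a b :: nat
  assumes "i < a" "j < b"
  shows "i * b + j < a * b"
proof -
  have "i * b + j < Suc i * b" using assms by simp
  also have "\<dots> \<le> a * b" using assms by (intro mult_right_mono) auto
  finally show ?thesis .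
qed

lemma less_mult_obtain:
  fixes k a b :: nat
  assumes "k < a * b"
  obtains i j where "i < a" "j < b" "k = i * b + j"
proof (rule that[of "k div b" "k mod b"])
  have "0 < b" using assms by (cases b) auto
  thus "k mod b < b" by simp
  show "k div b < a" using assms by (simp add: less_mult_imp_div_less)
qed simp

lemma sum_list_sum_swap:
  "(\<Sum>K\<leftarrow>Ks. \<Sum>i\<in>A. f K i) = (\<Sum>i\<in>A. \<Sum>K\<leftarrow>Ks. f K i :: 'a :: comm_monoid_add)"
  by (induction Ks) (simp_all add: sum.distrib)

lemma sum_list_swap:
  "(\<Sum>K\<leftarrow>Ks. \<Sum>L\<leftarrow>Ls. f K L) = (\<Sum>L\<leftarrow>Ls. \<Sum>K\<leftarrow>Ks. f K L :: 'a :: comm_monoid_add)"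
  by (induction Ks) (simp_all add: sum_list_addf)

lemma sum_list_product:
  "(\<Sum>X\<leftarrow>[g K L. K \<leftarrow> Ks, L \<leftarrow> Ls]. f X) = (\<Sum>K\<leftarrow>Ks. \<Sum>L\<leftarrow>Ls. f (g K L) :: 'a :: comm_monoid_add)"
  by (induction Ks) (simp_all add: o_def)

lemma mat_adjoint_index:
  fixes A :: "complex mat"
  assumes "i < dim_col A" "j < dim_row A"
  shows "mat_adjoint A $$ (i, j) = cnj (A $$ (j, i))"
  using assms by (simp add: mat_adjoint_def mat_of_rows_index)

lemma mat_adjoint_carrier:
  fixes A :: "complex mat"
  shows "A \<in> carrier_mat a b \<Longrightarrow> mat_adjoint A \<in> carrier_mat b a"
  by (auto simp: mat_adjoint_def)

lemma kron_carrier: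
  "A \<in> carrier_mat a b \<Longrightarrow> B \<in> carrier_mat c d \<Longrightarrow> kron A B \<in> carrier_mat (a * c) (b * d)"
  by (auto simp: kron_def)

lemma kron_index:
  assumes "A \<in> carrier_mat a b" "B \<in> carrier_mat c d" "i < a" "j < b" "k < c" "l < d"
  shows "kron A B $$ (i * c + k, j * d + l) = A $$ (i, j) * B $$ (k, l)"
  using assms mult_add_less[of i a k c] mult_add_less[of j b l d] by (simp add: kron_def)

lemma apply_kraus_carrier: "apply_kraus e Ks \<rho> \<in> carrier_mat e e"
  by (simp add: apply_kraus_def)

lemma sandwich_index:
  assumes "K \<in> carrier_mat e d" "\<rho> \<in> carrier_mat d d" "i < e" "j < e"
  shows "(K * \<rho> * mat_adjoint K) $$ (i, j) = (\<Sum>k<d. \<Sum>l<d. K $$ (i, k) * \<rho> $$ (k, l) * cnj (K $$ (j, l)))"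
proof -
  have "(K * \<rho> * mat_adjoint K) $$ (i, j) = (\<Sum>l<d. \<Sum>k<d. K $$ (i, k) * \<rho> $$ (k, l) * cnj (K $$ (j, l)))"
    using assms mat_adjoint_carrier[OF assms(1)]
    by (subst assoc_mult_mat[of _ e d _ d _ e])
      (auto simp: scalar_prod_def mat_adjoint_index atLeast0LessThan sum_distrib_left mult.assoc
        intro: sum.swap)
  thus ?thesis by (subst sum.swap)
qed

lemma apply_kraus_index:
  assumes "set Ks \<subseteq> carrier_mat e d" "\<rho> \<in> carrier_mat d d" "i < e" "j < e"
  shows "apply_kraus e Ks \<rho> $$ (i, j) =
    (\<Sum>K\<leftarrow>Ks. \<Sum>k<d. \<Sum>l<d. K $$ (i, k) * \<rho> $$ (k, l) * cnj (K $$ (j, l)))"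
  using assms sandwich_index[of _ e d \<rho> i j]
  by (auto simp: apply_kraus_def intro!: arg_cong[of _ _ sum_list] map_cong)

definition kron_lists :: "complex mat list \<Rightarrow> complex mat list \<Rightarrow> complex mat list" where
  "kron_lists Ks Ls = [kron K L. K \<leftarrow> Ks, L \<leftarrow> Ls]"

lemma kron_lists_carrier:
  assumes "set Ks \<subseteq> carrier_mat e d" "set Ls \<subseteq> carrier_mat e' d'"
  shows "set (kron_lists Ks Ls) \<subseteq> carrier_mat (e * e') (d * d')"
  using assms by (auto simp: kron_lists_def intro!: kron_carrier)

lemma joint_kraus_conv: "joint_kraus r Ks Ls = map (kron (1\<^sub>m r)) (kron_lists Ks Ls)"
  by (simp add: joint_kraus_def kron_lists_def map_concat o_def)

text \<open>The identity factor contributes Kronecker deltas, so the outside indices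
  \<open>R\<close> and \<open>R'\<close> merely select a block of \<open>\<sigma>\<close>.\<close>

lemma apply_kraus_id_kron_index:
  assumes Xs: "set Xs \<subseteq> carrier_mat e d" and \<sigma>: "\<sigma> \<in> carrier_mat (r * d) (r * d)"
    and R: "R < r" "R' < r" and o: "i < e" "i' < e"
  shows "apply_kraus (r * e) (map (kron (1\<^sub>m r)) Xs) \<sigma> $$ (R * e + i, R' * e + i') =
    (\<Sum>X\<leftarrow>Xs. \<Sum>k<d. \<Sum>l<d. X $$ (i, k) * \<sigma> $$ (R * d + k, R' * d + l) * cnj (X $$ (i', l)))"
proof -
  have "(\<Sum>k<r * d. \<Sum>l<r * d. kron (1\<^sub>m r) X $$ (R * e + i, k) * \<sigma> $$ (k, l) * cnj (kron (1\<^sub>m r) X $$ (R' * e + i', l)))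
      = (\<Sum>k<d. \<Sum>l<d. X $$ (i, k) * \<sigma> $$ (R * d + k, R' * d + l) * cnj (X $$ (i', l)))"
    (is "?lhs = ?rhs")
    if X: "X \<in> set Xs" for X
  proof -
    have Xc: "X \<in> carrier_mat e d" using X Xs by auto
    have "?lhs = (\<Sum>S<r. \<Sum>k<d. \<Sum>S'<r. \<Sum>l<d. (if R = S then 1 else 0) * X $$ (i, k) *
        \<sigma> $$ (S * d + k, S' * d + l) * cnj ((if R' = S' then 1 else 0) * X $$ (i', l)))"
      unfolding sum_lessThan_mult_split
      by (intro sum.cong refl) (simp add: kron_index[OF one_carrier_mat Xc] R o)
    also have "\<dots> = (\<Sum>S<r. if R = S then \<Sum>k<d. \<Sum>S'<r. if R' = S' then \<Sum>l<d. X $$ (i, k) *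
        \<sigma> $$ (S * d + k, S' * d + l) * cnj (X $$ (i', l)) else 0 else 0)"
    proof (rule sum.cong[OF refl])
      fix S
      show "(\<Sum>k<d. \<Sum>S'<r. \<Sum>l<d. (if R = S then 1 else 0) * X $$ (i, k) *
          \<sigma> $$ (S * d + k, S' * d + l) * cnj ((if R' = S' then 1 else 0) * X $$ (i', l)))
        = (if R = S then \<Sum>k<d. \<Sum>S'<r. if R' = S' then \<Sum>l<d. X $$ (i, k) *
          \<sigma> $$ (S * d + k, S' * d + l) * cnj (X $$ (i', l)) else 0 else 0)"
      proof (cases "R = S")
        case True
        have "(\<Sum>l<d. 1 * X $$ (i, k) * \<sigma> $$ (S * d + k, S' * d + l) * cnj ((if R' = S' then 1 else 0) * X $$ (i', l)))
          = (if R' = S' then \<Sum>l<d. X $$ (i, k) * \<sigma> $$ (S * d + k, S' * d + l) * cnj (X $$ (i', l)) else 0)"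
          for k S' by (cases "R' = S'") simp_all
        thus ?thesis using True by (simp only: simp_thms if_True)
      qed simp
    qed
    also have "\<dots> = ?rhs" using R by (simp add: sum.delta)
    finally show ?thesis .
  qed
  moreover have "set (map (kron (1\<^sub>m r)) Xs) \<subseteq> carrier_mat (r * e) (r * d)"
    using Xs by (auto intro!: kron_carrier)
  ultimately show ?thesis using \<sigma> R o
    by (auto simp: apply_kraus_index mult_add_less o_def
        intro!: arg_cong[of _ _ sum_list] map_cong)
qed

text \<open>Consecutive Kraus operators multiply, in coordinates: \<open>a\<close> and
  \<open>b\<close> are rows of the later operator, \<open>u\<close> is the earlier one, and
  \<open>p\<close> is the state.\<close>

lemma sandwich_sum_swap:
  fixes a b :: "'i \<Rightarrow> complex"
  shows "(\<Sum>i\<in>I. \<Sum>j\<in>I. a i * (\<Sum>k\<in>K. \<Sum>l\<in>K. u i k * p k l * cnj (u j l)) * cnj (b j))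
    = (\<Sum>k\<in>K. \<Sum>l\<in>K. (\<Sum>i\<in>I. a i * u i k) * p k l * cnj (\<Sum>j\<in>I. b j * u j l))"
    (is "?lhs = ?rhs")
proof -
  have "?lhs = (\<Sum>i\<in>I. \<Sum>j\<in>I. \<Sum>k\<in>K. \<Sum>l\<in>K. a i * u i k * p k l * cnj (b j * u j l))"
    by (simp add: sum_distrib_left sum_distrib_right mult_ac)
  also have "\<dots> = (\<Sum>i\<in>I. \<Sum>k\<in>K. \<Sum>j\<in>I. \<Sum>l\<in>K. a i * u i k * p k l * cnj (b j * u j l))"
    by (intro sum.cong refl) (rule sum.swap)
  also have "\<dots> = (\<Sum>k\<in>K. \<Sum>i\<in>I. \<Sum>l\<in>K. \<Sum>j\<in>I. a i * u i k * p k l * cnj (b j * u j l))"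
    by (subst sum.swap) (intro sum.cong refl, rule sum.swap)
  also have "\<dots> = (\<Sum>k\<in>K. \<Sum>l\<in>K. \<Sum>i\<in>I. \<Sum>j\<in>I. a i * u i k * p k l * cnj (b j * u j l))"
    by (intro sum.cong refl) (rule sum.swap)
  also have "\<dots> = ?rhs"
    by (simp add: sum_distrib_left sum_distrib_right mult_ac)
  finally show ?thesis .
qed

text \<open>The completeness relation evaluated at the vector \<open>y\<close>. In this form, free
  of adjoints, it can be applied to one factor of a composite system at a time.\<close>

lemma instrument_norm:
  assumes I: "instrument d e M I"
  shows "(\<Sum>m<M. \<Sum>K\<leftarrow>I m. \<Sum>k<e. (\<Sum>i<d. K $$ (k, i) * y i) * cnj (\<Sum>i<d. K $$ (k, i) * y i))
    = (\<Sum>i<d. y i * cnj (y i))"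
proof -
  have c: "K \<in> carrier_mat e d" if "m < M" "K \<in> set (I m)" for m K
    using I that by (auto simp: instrument_def)
  have one: "(\<Sum>m<M. \<Sum>K\<leftarrow>I m. (mat_adjoint K * K) $$ (i, j)) = (if i = j then 1 else 0)"
    if "i < d" "j < d" for i j
    using I that by (auto simp: instrument_def mat_eq_iff)
  have "(\<Sum>m<M. \<Sum>K\<leftarrow>I m. \<Sum>k<e. (\<Sum>i<d. K $$ (k, i) * y i) * cnj (\<Sum>i<d. K $$ (k, i) * y i))
     = (\<Sum>m<M. \<Sum>K\<leftarrow>I m. \<Sum>i<d. \<Sum>j<d. cnj (y i) * y j * (mat_adjoint K * K) $$ (i, j))"
  proof (rule sum.cong[OF refl], rule arg_cong[of _ _ sum_list], rule map_cong[OF refl])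
    fix m K assume mK: "m \<in> {..<M}" "K \<in> set (I m)"
    have "(\<Sum>k<e. (\<Sum>i<d. K $$ (k, i) * y i) * cnj (\<Sum>i<d. K $$ (k, i) * y i))
      = (\<Sum>k<e. \<Sum>i<d. \<Sum>j<d. cnj (y i) * y j * (cnj (K $$ (k, i)) * K $$ (k, j)))"
      unfolding cnj_sum sum_product by (rule sum.cong[OF refl], subst sum.swap) (simp add: mult_ac)
    also have "\<dots> = (\<Sum>i<d. \<Sum>k<e. \<Sum>j<d. cnj (y i) * y j * (cnj (K $$ (k, i)) * K $$ (k, j)))"
      by (rule sum.swap)
    also have "\<dots> = (\<Sum>i<d. \<Sum>j<d. \<Sum>k<e. cnj (y i) * y j * (cnj (K $$ (k, i)) * K $$ (k, j)))"
      by (rule sum.cong[OF refl]) (rule sum.swap)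
    also have "\<dots> = (\<Sum>i<d. \<Sum>j<d. cnj (y i) * y j * (mat_adjoint K * K) $$ (i, j))"
      using c[of m K] mK mat_adjoint_carrier[of K e d]
      by (intro sum.cong refl) (auto simp: scalar_prod_def mat_adjoint_index
          atLeast0LessThan sum_distrib_left)
    finally show "(\<Sum>k<e. (\<Sum>i<d. K $$ (k, i) * y i) * cnj (\<Sum>i<d. K $$ (k, i) * y i))
      = (\<Sum>i<d. \<Sum>j<d. cnj (y i) * y j * (mat_adjoint K * K) $$ (i, j))" .
  qed
  also have "\<dots> = (\<Sum>m<M. \<Sum>i<d. \<Sum>j<d. cnj (y i) * y j * (\<Sum>K\<leftarrow>I m. (mat_adjoint K * K) $$ (i, j)))"
    by (simp add: sum_list_sum_swap sum_list_const_mult)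
  also have "\<dots> = (\<Sum>i<d. \<Sum>m<M. \<Sum>j<d. cnj (y i) * y j * (\<Sum>K\<leftarrow>I m. (mat_adjoint K * K) $$ (i, j)))"
    by (rule sum.swap)
  also have "\<dots> = (\<Sum>i<d. \<Sum>j<d. cnj (y i) * y j * (\<Sum>m<M. \<Sum>K\<leftarrow>I m. (mat_adjoint K * K) $$ (i, j)))"
    by (rule sum.cong[OF refl], subst sum.swap) (simp add: sum_distrib_left)
  also have "\<dots> = (\<Sum>i<d. \<Sum>j<d. if j = i then cnj (y i) * y j else 0)"
    by (intro sum.cong refl) (simp add: one)
  also have "\<dots> = (\<Sum>i<d. y i * cnj (y i))"
    by (simp add: mult_ac)
  finally show ?thesis .
qed

lemma kron_instrument_norm:
  assumes I: "instrument d e M I" and J: "instrument d' e' M' J"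
  shows "(\<Sum>a<M. \<Sum>b<M'. \<Sum>X\<leftarrow>kron_lists (I a) (J b). \<Sum>k<e * e'.
      (\<Sum>i<d * d'. X $$ (k, i) * y i) * cnj (\<Sum>i<d * d'. X $$ (k, i) * y i))
    = (\<Sum>i<d * d'. y i * cnj (y i))" (is "?lhs = _")
proof -
  \<comment> \<open>Row \<open>l\<close> of \<open>L\<close> contracted with \<open>y\<close> leaves
    a vector on the first factor, to which the instrument \<open>I\<close> applies; \<open>J\<close>
    is summed out afterwards.\<close>
  define z where "z L l i = (\<Sum>j<d'. L $$ (l, j) * y (i * d' + j))" for L :: "complex mat" and l i
  have cI: "K \<in> carrier_mat e d" if "m < M" "K \<in> set (I m)" for m K
    using I that by (auto simp: instrument_def)
  have cJ: "K \<in> carrier_mat e' d'" if "m < M'" "K \<in> set (J m)" for m K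
    using J that by (auto simp: instrument_def)
  have "?lhs = (\<Sum>a<M. \<Sum>b<M'. \<Sum>K\<leftarrow>I a. \<Sum>L\<leftarrow>J b. \<Sum>k<e. \<Sum>l<e'.
      (\<Sum>i<d. K $$ (k, i) * z L l i) * cnj (\<Sum>i<d. K $$ (k, i) * z L l i))"
    unfolding kron_lists_def sum_list_product sum_lessThan_mult_split z_def
    by (intro sum.cong refl arg_cong[of _ _ sum_list] map_cong)
      (simp add: kron_index[OF cI cJ] sum_distrib_left mult.assoc)
  also have "\<dots> = (\<Sum>b<M'. \<Sum>a<M. \<Sum>L\<leftarrow>J b. \<Sum>K\<leftarrow>I a. \<Sum>l<e'. \<Sum>k<e.
      (\<Sum>i<d. K $$ (k, i) * z L l i) * cnj (\<Sum>i<d. K $$ (k, i) * z L l i))"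
    by (subst sum.swap, rule sum.cong[OF refl], rule sum.cong[OF refl], subst sum_list_swap,
        subst sum.swap[of _ "{..<e'}"]) (rule refl)
  also have "\<dots> = (\<Sum>b<M'. \<Sum>L\<leftarrow>J b. \<Sum>l<e'. \<Sum>a<M. \<Sum>K\<leftarrow>I a. \<Sum>k<e.
      (\<Sum>i<d. K $$ (k, i) * z L l i) * cnj (\<Sum>i<d. K $$ (k, i) * z L l i))"
    by (simp only: sum_list_sum_swap sum.swap[of _ "{..<e'}" "{..<M}"])
  also have "\<dots> = (\<Sum>b<M'. \<Sum>L\<leftarrow>J b. \<Sum>l<e'. \<Sum>i<d. z L l i * cnj (z L l i))"
    by (simp only: instrument_norm[OF I])
  also have "\<dots> = (\<Sum>i<d. \<Sum>b<M'. \<Sum>L\<leftarrow>J b. \<Sum>l<e'. z L l i * cnj (z L l i))"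
    by (simp only: sum.swap[of _ "{..<d}" "{..<e'}"] sum_list_sum_swap sum.swap[of _ "{..<d}" "{..<M'}"])
  also have "\<dots> = (\<Sum>i<d. \<Sum>j<d'. y (i * d' + j) * cnj (y (i * d' + j)))"
    unfolding z_def by (simp only: instrument_norm[OF J])
  finally show ?thesis by (simp add: sum_lessThan_mult_split)
qed

section \<open>The branches of an attack on a pure resource state\<close>

definition branch_sum ::
    "attack \<Rightarrow> bool list \<Rightarrow> bool list \<Rightarrow> (complex mat \<Rightarrow> complex mat \<Rightarrow> complex) \<Rightarrow> complex" where
  "branch_sum P x y F = (\<Sum>a<msgsA P. \<Sum>b<msgsB P.
     \<Sum>Y\<leftarrow>kron_lists (secondA P x a b) (secondB P y a b).
       \<Sum>X\<leftarrow>kron_lists (firstA P x a) (firstB P y b). F Y X)"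

text \<open>Lists may repeat an operator, so \<open>branch_sum\<close> counts multiplicities; the
  set form serves to state what holds in every branch.\<close>

definition branches :: "attack \<Rightarrow> bool list \<Rightarrow> bool list \<Rightarrow> (complex mat \<times> complex mat) set" where
  "branches P x y = (\<Union>a<msgsA P. \<Union>b<msgsB P.
     set (kron_lists (secondA P x a b) (secondB P y a b)) \<times> set (kron_lists (firstA P x a) (firstB P y b)))"

lemma branch_sum_cong:
  assumes "\<And>Y X. (Y, X) \<in> branches P x y \<Longrightarrow> F Y X = F' Y X"
  shows "branch_sum P x y F = branch_sum P x y F'"
  unfolding branch_sum_def
  by (rule sum.cong[OF refl], rule sum.cong[OF refl], rule arg_cong[of _ _ sum_list], rule map_cong[OF refl],
      rule arg_cong[of _ _ sum_list], rule map_cong[OF refl], rule assms) (auto simp: branches_def)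

lemma branch_sum_sum: "branch_sum P x y (\<lambda>Y X. \<Sum>i\<in>A. F Y X i) = (\<Sum>i\<in>A. branch_sum P x y (\<lambda>Y X. F Y X i))"
  unfolding branch_sum_def by (simp only: sum_list_sum_swap sum.swap[of _ A])

lemma branch_sum_mult_right: "branch_sum P x y (\<lambda>Y X. F Y X * c) = branch_sum P x y F * c"
  unfolding branch_sum_def by (simp only: sum_list_mult_const sum_distrib_right)

text \<open>Inserting the resource vector \<open>\<eta>\<close> into the product \<open>Y X\<close>
  leaves an operator from the unknown qubit to the two output qubits. This is its entry from the
  basis state \<open>q\<close> to the basis state \<open>i\<close>.\<close>

definition amplitude :: "(nat \<Rightarrow> complex) \<Rightarrow> nat \<Rightarrow> complex mat \<Rightarrow> complex mat \<Rightarrow> nat \<Rightarrow> nat \<Rightarrow> complex" where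
  "amplitude \<eta> D Y X i q = (\<Sum>k<dim_col Y. Y $$ (i, k) * (\<Sum>l<D. X $$ (k, q * D + l) * \<eta> l))"

locale pure_attack =
  fixes n P \<eta> D x y
  assumes valid: "valid_attack n P" and x: "x \<in> bitstrings n" and y: "y \<in> bitstrings n"
    and D: "D = resA P * resB P"
    and pure: "shared P = mat D D (\<lambda>(i, j). \<eta> i * cnj (\<eta> j))"
begin

lemma instruments:
  "instrument (2 * resA P) (memA P) (msgsA P) (firstA P x)"
  "instrument (resB P) (memB P) (msgsB P) (firstB P y)"
  using valid x y by (auto simp: valid_attack_def)

lemma channels:
  assumes "a < msgsA P" "b < msgsB P"
  shows "channel (memA P) 2 (secondA P x a b)" "channel (memB P) 2 (secondB P y a b)"
  using valid x y assms by (auto simp: valid_attack_def)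

lemma first_carrier:
  assumes "a < msgsA P" "b < msgsB P"
  shows "set (kron_lists (firstA P x a) (firstB P y b)) \<subseteq> carrier_mat (memA P * memB P) (2 * D)"
  unfolding D mult.assoc[symmetric]
  using instruments assms by (intro kron_lists_carrier) (auto simp: instrument_def)

lemma second_carrier:
  assumes "a < msgsA P" "b < msgsB P"
  shows "set (kron_lists (secondA P x a b) (secondB P y a b)) \<subseteq> carrier_mat (2 * 2) (memA P * memB P)"
  using channels[OF assms] by (intro kron_lists_carrier) (auto simp: channel_def instrument_def)

text \<open>As the resource is pure, each branch is a single operator on the unknown qubit, and it
  acts on every outside block separately.\<close>

lemma final_state_index:
  assumes \<rho>: "\<rho> \<in> carrier_mat (r * 2) (r * 2)" and R: "R < r" "R' < r" and i: "i < 4" "i' < 4"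
  shows "final_state P x y r \<rho> $$ (R * 4 + i, R' * 4 + i') = branch_sum P x y (\<lambda>Y X.
    \<Sum>q<2. \<Sum>q'<2. amplitude \<eta> D Y X i q * \<rho> $$ (R * 2 + q, R' * 2 + q') * cnj (amplitude \<eta> D Y X i' q'))"
proof -
  let ?m = "memA P * memB P"
  let ?\<rho> = "\<lambda>q q'. \<rho> $$ (R * 2 + q, R' * 2 + q')"
  let ?u = "\<lambda>X k q. \<Sum>l<D. X $$ (k, q * D + l) * \<eta> l"
  let ?\<sigma> = "kron \<rho> (shared P)"
  have sh: "shared P \<in> carrier_mat D D" by (simp add: pure)
  have \<sigma>: "?\<sigma> \<in> carrier_mat (r * (2 * D)) (r * (2 * D))"
    using kron_carrier[OF \<rho> sh] by (simp add: mult.assoc)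
  have \<sigma>_index: "?\<sigma> $$ (R * (2 * D) + (q * D + l), R' * (2 * D) + (q' * D + l')) = ?\<rho> q q' * (\<eta> l * cnj (\<eta> l'))"
    if "q < 2" "q' < 2" "l < D" "l' < D" for q q' l l'
  proof -
    have eq: "R * (2 * D) + (q * D + l) = (R * 2 + q) * D + l" for R q l by (simp add: algebra_simps)
    have "R * 2 + q < r * 2" "R' * 2 + q' < r * 2" using R that by auto
    thus ?thesis unfolding eq using that by (subst kron_index[OF \<rho> sh]) (auto simp: pure)
  qed
  have first: "apply_kraus (r * ?m) (joint_kraus r (firstA P x a) (firstB P y b)) ?\<sigma> $$ (R * ?m + k, R' * ?m + k')
      = (\<Sum>X\<leftarrow>kron_lists (firstA P x a) (firstB P y b). \<Sum>q<2. \<Sum>q'<2. ?u X k q * ?\<rho> q q' * cnj (?u X k' q'))"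
    if "a < msgsA P" "b < msgsB P" "k < ?m" "k' < ?m" for a b k k'
  proof -
    have "(\<Sum>q<2. \<Sum>l<D. \<Sum>q'<2. \<Sum>l'<D. X $$ (k, q * D + l) *
        ?\<sigma> $$ (R * (2 * D) + (q * D + l), R' * (2 * D) + (q' * D + l')) * cnj (X $$ (k', q' * D + l')))
       = (\<Sum>q<2. \<Sum>q'<2. ?u X k q * ?\<rho> q q' * cnj (?u X k' q'))" (is "?lhs = _") for X
    proof -
      have "?lhs = (\<Sum>q<2. \<Sum>l<D. \<Sum>q'<2. \<Sum>l'<D. (X $$ (k, q * D + l) * \<eta> l) * ?\<rho> q q' * cnj (X $$ (k', q' * D + l') * \<eta> l'))"
        by (intro sum.cong refl, subst \<sigma>_index) (simp_all add: mult_ac)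
      also have "\<dots> = (\<Sum>q<2. \<Sum>q'<2. \<Sum>l<D. \<Sum>l'<D. (X $$ (k, q * D + l) * \<eta> l) * ?\<rho> q q' * cnj (X $$ (k', q' * D + l') * \<eta> l'))"
        by (rule sum.cong[OF refl]) (rule sum.swap)
      also have "\<dots> = (\<Sum>q<2. \<Sum>q'<2. ?u X k q * ?\<rho> q q' * cnj (?u X k' q'))"
        unfolding cnj_sum sum_distrib_left sum_distrib_right
        by (rule sum.cong[OF refl], rule sum.cong[OF refl]) (rule sum.swap)
      finally show ?thesis .
    qed
    thus ?thesis unfolding joint_kraus_conv
      by (subst apply_kraus_id_kron_index[OF first_carrier[OF that(1,2)] \<sigma> R that(3,4)])
        (simp only: sum_lessThan_mult_split)
  qed
  have second: "apply_kraus (r * (2 * 2)) (joint_kraus r (secondA P x a b) (secondB P y a b))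
      (apply_kraus (r * ?m) (joint_kraus r (firstA P x a) (firstB P y b)) ?\<sigma>) $$ (R * (2 * 2) + i, R' * (2 * 2) + i')
      = (\<Sum>Y\<leftarrow>kron_lists (secondA P x a b) (secondB P y a b). \<Sum>X\<leftarrow>kron_lists (firstA P x a) (firstB P y b).
          \<Sum>q<2. \<Sum>q'<2. amplitude \<eta> D Y X i q * ?\<rho> q q' * cnj (amplitude \<eta> D Y X i' q'))"
    (is "?lhs = _")
    if ab: "a < msgsA P" "b < msgsB P" for a b
  proof -
    have "?lhs = (\<Sum>Y\<leftarrow>kron_lists (secondA P x a b) (secondB P y a b). \<Sum>k<?m. \<Sum>k'<?m. Y $$ (i, k) *
        (\<Sum>X\<leftarrow>kron_lists (firstA P x a) (firstB P y b). \<Sum>q<2. \<Sum>q'<2. ?u X k q * ?\<rho> q q' * cnj (?u X k' q')) *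
        cnj (Y $$ (i', k')))"
      unfolding joint_kraus_conv[of _ "secondA P x a b"]
      using i by (subst apply_kraus_id_kron_index[OF second_carrier[OF ab] apply_kraus_carrier R])
        (auto simp: first[OF ab] intro!: arg_cong[of _ _ sum_list] map_cong)
    also have "\<dots> = (\<Sum>Y\<leftarrow>kron_lists (secondA P x a b) (secondB P y a b).
        \<Sum>X\<leftarrow>kron_lists (firstA P x a) (firstB P y b). \<Sum>k<?m. \<Sum>k'<?m. Y $$ (i, k) *
        (\<Sum>q<2. \<Sum>q'<2. ?u X k q * ?\<rho> q q' * cnj (?u X k' q')) * cnj (Y $$ (i', k')))"
      by (simp only: sum_list_sum_swap sum_list_mult_const sum_list_const_mult)
    also have "\<dots> = (\<Sum>Y\<leftarrow>kron_lists (secondA P x a b) (secondB P y a b). \<Sum>X\<leftarrow>kron_lists (firstA P x a) (firstB P y b).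
          \<Sum>q<2. \<Sum>q'<2. amplitude \<eta> D Y X i q * ?\<rho> q q' * cnj (amplitude \<eta> D Y X i' q'))"
      using second_carrier[OF ab] unfolding sandwich_sum_swap amplitude_def
      by (intro arg_cong[of _ _ sum_list] map_cong refl) (auto dest!: subsetD)
    finally show ?thesis .
  qed
  have "R * 4 + i < r * (2 * 2)" "R' * 4 + i' < r * (2 * 2)"
    using mult_add_less[OF R(1) i(1)] mult_add_less[OF R(2) i(2)] by simp_all
  thus ?thesis unfolding final_state_def branch_sum_def using second by simp
qed

lemma amplitude_norm:
  assumes \<eta>: "(\<Sum>l<D. \<eta> l * cnj (\<eta> l)) = 1" and q: "q < 2"
  shows "branch_sum P x y (\<lambda>Y X. \<Sum>i<2 * 2. amplitude \<eta> D Y X i q * cnj (amplitude \<eta> D Y X i q)) = 1"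
proof -
  let ?m = "memA P * memB P"
  let ?u = "\<lambda>X k. \<Sum>l<D. X $$ (k, q * D + l) * \<eta> l"
  \<comment> \<open>The input vector whose norm both rounds preserve: the basis state
    \<open>q\<close> tensored with \<open>\<eta>\<close>.\<close>
  define z where "z l = (if l div D = q then \<eta> (l mod D) else 0)" for l
  have z: "z (q' * D + l) = (if q' = q then \<eta> l else 0)" if "l < D" for q' l
    using that by (simp add: z_def)
  have u_z: "?u X k = (\<Sum>l<2 * D. X $$ (k, l) * z l)" for X k
  proof -
    have "(\<Sum>l<2 * D. X $$ (k, l) * z l) = (\<Sum>q'<2. if q' = q then ?u X k else 0)"
      unfolding sum_lessThan_mult_split by (rule sum.cong[OF refl]) (simp add: z)
    thus ?thesis using q by simp
  qed
  have "branch_sum P x y (\<lambda>Y X. \<Sum>i<2 * 2. amplitude \<eta> D Y X i q * cnj (amplitude \<eta> D Y X i q)) =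
    (\<Sum>a<msgsA P. \<Sum>b<msgsB P. \<Sum>X\<leftarrow>kron_lists (firstA P x a) (firstB P y b). \<Sum>k<?m. ?u X k * cnj (?u X k))"
    unfolding branch_sum_def
  proof (rule sum.cong[OF refl], rule sum.cong[OF refl])
    fix a b assume ab: "a \<in> {..<msgsA P}" "b \<in> {..<msgsB P}"
    have c: "dim_col Y = ?m" if "Y \<in> set (kron_lists (secondA P x a b) (secondB P y a b))" for Y
      using that second_carrier ab by auto
    have second_norm: "(\<Sum>Y\<leftarrow>kron_lists (secondA P x a b) (secondB P y a b). \<Sum>i<2 * 2.
        (\<Sum>k<?m. Y $$ (i, k) * w k) * cnj (\<Sum>k<?m. Y $$ (i, k) * w k)) = (\<Sum>k<?m. w k * cnj (w k))" for w
      using kron_instrument_norm[OF channels[of a b, unfolded channel_def]] ab by simp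
    have "(\<Sum>Y\<leftarrow>kron_lists (secondA P x a b) (secondB P y a b). \<Sum>X\<leftarrow>kron_lists (firstA P x a) (firstB P y b).
        \<Sum>i<2 * 2. amplitude \<eta> D Y X i q * cnj (amplitude \<eta> D Y X i q))
      = (\<Sum>X\<leftarrow>kron_lists (firstA P x a) (firstB P y b). \<Sum>Y\<leftarrow>kron_lists (secondA P x a b) (secondB P y a b).
        \<Sum>i<2 * 2. (\<Sum>k<?m. Y $$ (i, k) * ?u X k) * cnj (\<Sum>k<?m. Y $$ (i, k) * ?u X k))"
      by (subst sum_list_swap)
        (auto simp: amplitude_def c intro!: arg_cong[of _ _ sum_list] map_cong)
    also have "\<dots> = (\<Sum>X\<leftarrow>kron_lists (firstA P x a) (firstB P y b). \<Sum>k<?m. ?u X k * cnj (?u X k))"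
      by (simp only: second_norm)
    finally show "(\<Sum>Y\<leftarrow>kron_lists (secondA P x a b) (secondB P y a b). \<Sum>X\<leftarrow>kron_lists (firstA P x a) (firstB P y b).
        \<Sum>i<2 * 2. amplitude \<eta> D Y X i q * cnj (amplitude \<eta> D Y X i q))
      = (\<Sum>X\<leftarrow>kron_lists (firstA P x a) (firstB P y b). \<Sum>k<?m. ?u X k * cnj (?u X k))" .
  qed
  also have "\<dots> = (\<Sum>a<msgsA P. \<Sum>b<msgsB P. \<Sum>X\<leftarrow>kron_lists (firstA P x a) (firstB P y b).
      \<Sum>k<?m. (\<Sum>l<2 * D. X $$ (k, l) * z l) * cnj (\<Sum>l<2 * D. X $$ (k, l) * z l))"
    by (simp only: u_z)
  also have "(\<Sum>a<msgsA P. \<Sum>b<msgsB P. \<Sum>X\<leftarrow>kron_lists (firstA P x a) (firstB P y b).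
      \<Sum>k<?m. (\<Sum>l<2 * D. X $$ (k, l) * z l) * cnj (\<Sum>l<2 * D. X $$ (k, l) * z l)) = (\<Sum>l<2 * D. z l * cnj (z l))"
    using kron_instrument_norm[OF instruments] unfolding D mult.assoc .
  also have "\<dots> = (\<Sum>q'<2. if q' = q then 1 else 0)"
    unfolding sum_lessThan_mult_split by (rule sum.cong[OF refl]) (simp add: z \<eta>)
  finally show ?thesis using q by simp
qed

text \<open>Here \<open>pos h g\<close> is the index of the pair of output qubits in which the holder's bit is \<open>h\<close>
  and the other player's bit is \<open>g\<close>.\<close>

lemma holder_marginal:
  fixes pos :: "nat \<Rightarrow> nat \<Rightarrow> nat"
  assumes \<eta>: "(\<Sum>l<D. \<eta> l * cnj (\<eta> l)) = 1"
    and \<rho>: "\<rho> \<in> carrier_mat (r * 2) (r * 2)" and R: "R < r" "R' < r" and h: "h < 2" "h' < 2"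
    and pos: "\<And>h g. h < 2 \<Longrightarrow> g < 2 \<Longrightarrow> pos h g < 4"
      "\<And>F :: nat \<Rightarrow> complex. (\<Sum>i<2 * 2. F i) = (\<Sum>h<2. \<Sum>g<2. F (pos h g))"
    and zero: "\<And>Y X h g q. (Y, X) \<in> branches P x y \<Longrightarrow> h < 2 \<Longrightarrow> g < 2 \<Longrightarrow> q < 2 \<Longrightarrow> q \<noteq> h \<Longrightarrow>
      amplitude \<eta> D Y X (pos h g) q = 0"
    and same: "\<And>Y X g. (Y, X) \<in> branches P x y \<Longrightarrow> g < 2 \<Longrightarrow>
      amplitude \<eta> D Y X (pos 1 g) 1 = amplitude \<eta> D Y X (pos 0 g) 0"
  shows "(\<Sum>g<2. final_state P x y r \<rho> $$ (R * 4 + pos h g, R' * 4 + pos h' g)) = \<rho> $$ (R * 2 + h, R' * 2 + h')"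
proof -
  \<comment> \<open>By \<open>zero\<close> and \<open>same\<close>, the part of a branch in which
    the other player outputs \<open>g\<close> carries the unknown qubit to the holder up to the
    scalar \<open>?v Y X g\<close>.\<close>
  let ?v = "\<lambda>Y X g. amplitude \<eta> D Y X (pos 0 g) 0"
  have v: "amplitude \<eta> D Y X (pos h g) h = ?v Y X g" if "(Y, X) \<in> branches P x y" "h < 2" "g < 2" for Y X h g
  proof (cases "h = 0")
    case False
    hence "h = 1" using that(2) by simp
    thus ?thesis using same[OF that(1,3)] by simp
  qed simp
  have pick: "(\<Sum>q<2. F q) = F h" if "h < 2" "\<And>q. q < 2 \<Longrightarrow> q \<noteq> h \<Longrightarrow> F q = 0" for F :: "nat \<Rightarrow> complex" and h
  proof -
    have "(\<Sum>q<2. F q) = (\<Sum>q\<in>{h}. F q)" by (rule sum.mono_neutral_right) (use that in auto)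
    thus ?thesis by simp
  qed
  have "(\<Sum>g<2. final_state P x y r \<rho> $$ (R * 4 + pos h g, R' * 4 + pos h' g))
    = (\<Sum>g<2. branch_sum P x y (\<lambda>Y X. ?v Y X g * cnj (?v Y X g) * \<rho> $$ (R * 2 + h, R' * 2 + h')))"
  proof (rule sum.cong[OF refl])
    fix g :: nat assume "g \<in> {..<2}"
    hence g2: "g < 2" by simp
    show "final_state P x y r \<rho> $$ (R * 4 + pos h g, R' * 4 + pos h' g)
      = branch_sum P x y (\<lambda>Y X. ?v Y X g * cnj (?v Y X g) * \<rho> $$ (R * 2 + h, R' * 2 + h'))"
      unfolding final_state_index[OF \<rho> R pos(1)[OF h(1) g2] pos(1)[OF h(2) g2]]
    proof (rule branch_sum_cong)
      fix Y X assume YX: "(Y, X) \<in> branches P x y"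
      let ?a = "amplitude \<eta> D Y X"
      let ?s = "\<lambda>q. \<Sum>q'<2. ?a (pos h g) q * \<rho> $$ (R * 2 + q, R' * 2 + q') * cnj (?a (pos h' g) q')"
      have "(\<Sum>q<2. ?s q) = ?s h"
        using zero[OF YX h(1) g2] by (intro pick h) simp
      also have "\<dots> = ?a (pos h g) h * \<rho> $$ (R * 2 + h, R' * 2 + h') * cnj (?a (pos h' g) h')"
        using zero[OF YX h(2) g2] by (intro pick h) simp
      also have "\<dots> = ?v Y X g * cnj (?v Y X g) * \<rho> $$ (R * 2 + h, R' * 2 + h')"
        unfolding v[OF YX h(1) g2] v[OF YX h(2) g2] by (simp only: mult_ac)
      finally show "(\<Sum>q<2. ?s q) = \<dots>" .
    qed
  qed
  also have "\<dots> = branch_sum P x y (\<lambda>Y X. \<Sum>g<2. ?v Y X g * cnj (?v Y X g)) * \<rho> $$ (R * 2 + h, R' * 2 + h')"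
    by (simp only: branch_sum_mult_right branch_sum_sum sum_distrib_right)
  \<comment> \<open>The total weight of the scalars is read off from the input \<open>q = 0\<close>:
    the summands with \<open>h = 1\<close> that complete the norm vanish by
    \<open>zero\<close>.\<close>
  also have "branch_sum P x y (\<lambda>Y X. \<Sum>g<2. ?v Y X g * cnj (?v Y X g))
    = branch_sum P x y (\<lambda>Y X. \<Sum>i<2 * 2. amplitude \<eta> D Y X i 0 * cnj (amplitude \<eta> D Y X i 0))"
    unfolding pos(2)
  proof (rule branch_sum_cong)
    fix Y X assume YX: "(Y, X) \<in> branches P x y"
    show "(\<Sum>g<2. ?v Y X g * cnj (?v Y X g)) =
      (\<Sum>h<2. \<Sum>g<2. amplitude \<eta> D Y X (pos h g) 0 * cnj (amplitude \<eta> D Y X (pos h g) 0))"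
      using zero[OF YX] by (intro pick[symmetric] sum.neutral) auto
  qed
  also have "\<dots> = 1" by (rule amplitude_norm[OF \<eta>]) simp
  finally show ?thesis by simp
qed

end

section \<open>The path of the water\<close>

definition links :: "hose_game \<Rightarrow> bool list \<Rightarrow> bool list \<Rightarrow> hose_vertex set set" where
  "links G x y = linksA G x \<union> linksB G y"

lemma game_edges_links: "game_edges G x y = pipes (num_pipes G) \<union> links G x y"
  by (auto simp: game_edges_def links_def)

lemma verticesA0_not_B: "v \<in> verticesA0 s \<Longrightarrow> v \<notin> verticesB s"
  by (auto simp: verticesA0_def verticesA_def verticesB_def)

lemma finite_vertices: "finite (verticesA0 s)" "finite (verticesB s)"
  by (auto simp: verticesA0_def verticesA_def verticesB_def)

lemma graph_edges_vertex: "graph_edges V E \<Longrightarrow> {u, v} \<in> E \<Longrightarrow> u \<in> V"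
  unfolding graph_edges_def by (drule (1) subsetD) (auto simp: doubleton_eq_iff)

lemma linksA_vertex:
  assumes "garden_hose_game n G" "x \<in> bitstrings n" "{u, v} \<in> linksA G x"
  shows "u \<in> verticesA0 (num_pipes G)"
proof -
  have "graph_edges (verticesA0 (num_pipes G)) (linksA G x)"
    using assms by (auto simp: garden_hose_game_def)
  from graph_edges_vertex[OF this assms(3)] show ?thesis .
qed

lemma linksB_vertex:
  assumes "garden_hose_game n G" "y \<in> bitstrings n" "{u, v} \<in> linksB G y"
  shows "u \<in> verticesB (num_pipes G)"
proof -
  have "graph_edges (verticesB (num_pipes G)) (linksB G y)"
    using assms by (auto simp: garden_hose_game_def)
  from graph_edges_vertex[OF this assms(3)] show ?thesis .
qed

lemma links_unique:
  assumes G: "garden_hose_game n G" "x \<in> bitstrings n" "y \<in> bitstrings n"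
    and e: "{u, v} \<in> links G x y" "{u, w} \<in> links G x y"
  shows "v = w"
proof -
  let ?s = "num_pipes G"
  have gA: "graph_edges (verticesA0 ?s) (linksA G x)"
    and dA: "\<And>v. v \<in> verticesA0 ?s \<Longrightarrow> degree_in (linksA G x) v \<le> 1"
    and gB: "graph_edges (verticesB ?s) (linksB G y)"
    and dB: "\<And>v. v \<in> verticesB ?s \<Longrightarrow> degree_in (linksB G y) v \<le> 1"
    using G by (auto simp: garden_hose_game_def)
  have A: "v = w" if "{u, v} \<in> linksA G x" "{u, w} \<in> linksA G x"
    using degree_le_1_unique[OF gA finite_vertices(1) dA[OF linksA_vertex[OF G(1,2) that(1)]] that] by simp
  have B: "v = w" if "{u, v} \<in> linksB G y" "{u, w} \<in> linksB G y"
    using degree_le_1_unique[OF gB finite_vertices(2) dB[OF linksB_vertex[OF G(1,3) that(1)]] that] by simp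
  show ?thesis using e A B linksA_vertex[OF G(1,2)] linksB_vertex[OF G(1,3)] verticesA0_not_B
    unfolding links_def Un_iff by metis
qed

lemma links_irrefl:
  assumes "garden_hose_game n G" "x \<in> bitstrings n" "y \<in> bitstrings n" "{u, v} \<in> links G x y"
  shows "u \<noteq> v"
proof -
  have "u \<noteq> v" if "graph_edges V E" "{u, v} \<in> E" for V E
  proof -
    from subsetD[OF that(1)[unfolded graph_edges_def] that(2)]
    obtain a b where "{u, v} = {a, b}" "a \<noteq> b" by auto
    thus ?thesis by (auto simp: doubleton_eq_iff)
  qed
  moreover have "graph_edges (verticesA0 (num_pipes G)) (linksA G x)"
    "graph_edges (verticesB (num_pipes G)) (linksB G y)"
    using assms by (auto simp: garden_hose_game_def)
  ultimately show ?thesis using assms(4) unfolding links_def Un_iff by metis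
qed

lemma pipes_unique: "{u, v} \<in> pipes s \<Longrightarrow> {u, w} \<in> pipes s \<Longrightarrow> v = w"
  by (auto simp: pipes_def doubleton_eq_iff)

text \<open>The tap lies on no pipe, so the first edge is a link. Afterwards two edges of the same
  kind cannot follow each other: a vertex has at most one link and at most one pipe, so the path
  would turn back.\<close>

lemma graph_path_alternates:
  assumes G: "garden_hose_game n G" "x \<in> bitstrings n" "y \<in> bitstrings n"
    and p: "graph_path (game_vertices G) (game_edges G x y) p" "hd p = Tap"
    and i: "Suc i < length p"
  shows "{p ! i, p ! Suc i} \<in> (if even i then links G x y else pipes (num_pipes G))"
  using i
proof (induction i)
  case 0
  have "p ! 0 = Tap" using p by (simp add: graph_path_def hd_conv_nth)
  moreover have "{p ! 0, p ! Suc 0} \<in> game_edges G x y"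
    using p 0 by (simp add: graph_path_def successively_conv_nth)
  ultimately show ?case by (auto simp: game_edges_links pipes_def doubleton_eq_iff)
next
  case (Suc i)
  have ne: "p ! i \<noteq> p ! Suc (Suc i)"
    using p Suc.prems by (simp add: graph_path_def nth_eq_iff_index_eq)
  have e: "{p ! Suc i, p ! Suc (Suc i)} \<in> pipes (num_pipes G) \<union> links G x y"
    using p Suc.prems by (simp add: graph_path_def successively_conv_nth flip: game_edges_links)
  have prev: "{p ! Suc i, p ! i} \<in> (if even i then links G x y else pipes (num_pipes G))"
    using Suc by (simp add: insert_commute)
  show ?case
  proof (cases "even i")
    case True
    hence "{p ! Suc i, p ! i} \<in> links G x y" using prev by simp
    hence "{p ! Suc i, p ! Suc (Suc i)} \<notin> links G x y" using ne links_unique[OF G] by blast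
    thus ?thesis using e True by simp
  next
    case False
    hence "{p ! Suc i, p ! i} \<in> pipes (num_pipes G)" using prev by simp
    hence "{p ! Suc i, p ! Suc (Suc i)} \<notin> pipes (num_pipes G)" using ne pipes_unique by blast
    thus ?thesis using e False by simp
  qed
qed

text \<open>What the teleportation needs of the maximal path: \<open>m\<close> links and
  \<open>m\<close> pipes in alternation, beginning with a link, and an end without a link. For
  \<open>m = 0\<close> the tap itself is unlinked.\<close>

locale water_flow =
  fixes n G x y p m
  assumes G: "garden_hose_game n G" and x: "x \<in> bitstrings n" and y: "y \<in> bitstrings n"
    and path: "graph_path (game_vertices G) (game_edges G x y) p"
    and start: "p ! 0 = Tap"
    and len: "length p = Suc (2 * m)"
    and link_step: "\<And>j. j < m \<Longrightarrow> {p ! (2 * j), p ! Suc (2 * j)} \<in> links G x y"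
    and pipe_step: "\<And>j. j < m \<Longrightarrow> {p ! Suc (2 * j), p ! Suc (Suc (2 * j))} \<in> pipes (num_pipes G)"
    and end_unlinked: "\<And>v. {p ! (2 * m), v} \<notin> links G x y"
begin

lemma distinct: "distinct p"
  using path by (simp add: graph_path_def)

lemma vertices: "set p \<subseteq> game_vertices G"
  using path by (simp add: graph_path_def)

lemma last_path: "last p = p ! (2 * m)"
  using len by (subst last_conv_nth) auto

lemma linked:
  assumes "v \<in> set p" "v \<noteq> last p"
  obtains u where "u \<in> set p" "{v, u} \<in> links G x y"
proof -
  obtain i where i: "i < length p" "v = p ! i" using assms(1) by (auto simp: in_set_conv_nth)
  define j where "j = i div 2"
  have "i \<noteq> 2 * m" using i assms last_path by auto
  hence j: "j < m" using i len by (auto simp: j_def)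
  have "i = 2 * j \<or> i = Suc (2 * j)" by (auto simp: j_def)
  thus ?thesis
  proof
    assume "i = 2 * j"
    thus ?thesis using that[of "p ! Suc (2 * j)"] link_step[OF j] i j len by simp
  next
    assume "i = Suc (2 * j)"
    thus ?thesis using that[of "p ! (2 * j)"] link_step[OF j] i j len by (simp add: insert_commute)
  qed
qed

text \<open>Each path vertex except the end has its only link inside the path, and the end has none.
  With \<open>pipe_closed\<close> it follows that flipping all bits on the path keeps equal bits
  equal across links and pipes.\<close>

lemma link_closed:
  assumes "{u, v} \<in> links G x y" "u \<in> set p"
  shows "v \<in> set p"
proof -
  have "u \<noteq> last p" using assms end_unlinked by (auto simp: last_path)
  then obtain w where "w \<in> set p" "{u, w} \<in> links G x y" using linked assms(2) by blast
  thus ?thesis using links_unique[OF G x y assms(1)] by blast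
qed

lemma pipe_closed:
  assumes e: "{u, v} \<in> pipes (num_pipes G)" and u: "u \<in> set p"
  shows "v \<in> set p"
proof -
  obtain i where i: "i < length p" "u = p ! i" using u by (auto simp: in_set_conv_nth)
  have "u \<noteq> Tap" using e by (auto simp: pipes_def doubleton_eq_iff)
  hence i0: "i > 0" using i start by (cases i) auto
  \<comment> \<open>Positions \<open>2 * j + 1\<close> and \<open>2 * j + 2\<close> hold the two
    ends of one pipe.\<close>
  define j where "j = (i - 1) div 2"
  have j: "j < m" using i i0 len by (auto simp: j_def)
  have "i = Suc (2 * j) \<or> i = Suc (Suc (2 * j))" using i0 unfolding j_def by presburger
  hence "\<exists>w \<in> set p. {u, w} \<in> pipes (num_pipes G)"
  proof
    assume "i = Suc (2 * j)"
    thus ?thesis using pipe_step[OF j] i j len by (intro bexI[of _ "p ! Suc (Suc (2 * j))"]) auto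
  next
    assume "i = Suc (Suc (2 * j))"
    thus ?thesis using pipe_step[OF j] i j len
      by (intro bexI[of _ "p ! Suc (2 * j)"]) (auto simp: insert_commute)
  qed
  thus ?thesis using pipes_unique[OF e] by blast
qed

end

lemma water_path_flow:
  assumes G: "garden_hose_game n G" "x \<in> bitstrings n" "y \<in> bitstrings n"
  shows "\<exists>m. water_flow n G x y (water_path G x y) m"
proof -
  define p where "p = water_path G x y"
  let ?V = "game_vertices G" and ?E = "game_edges G x y"
  have max: "maximal_path_from ?V ?E Tap p"
    unfolding p_def water_path_def by (rule theI'[OF water_path_unique[OF G]])
  hence gp: "graph_path ?V ?E p" and hd: "hd p = Tap" by (auto simp: maximal_path_from_def)
  note alt = graph_path_alternates[OF G gp hd]
  have ne: "p \<noteq> []" and dist: "distinct p" and pV: "set p \<subseteq> ?V" using gp by (auto simp: graph_path_def)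
  have stuck: "v \<in> set p" if "{last p, v} \<in> ?E" "v \<in> ?V" for v
  proof (rule ccontr)
    assume "v \<notin> set p"
    hence "graph_path ?V ?E (p @ [v])"
      using gp that by (auto simp: graph_path_def successively_append_iff)
    thus False using max by (auto simp: maximal_path_from_def)
  qed
  have start: "p ! 0 = Tap" using hd ne by (simp add: hd_conv_nth)
  have last: "last p = p ! (length p - 1)" using ne by (simp add: last_conv_nth)
  \<comment> \<open>With an even number of vertices the last step would be a link. By maximality the
    pipe at the end leads back into the path, but the vertex reached there has its pipe partner
    strictly before the end.\<close>
  have odd: "odd (length p)"
  proof
    assume ev: "even (length p)"
    then obtain j where "length p = 2 * j" by (elim evenE)
    moreover from this have "j \<noteq> 0" using ne by (cases j) auto
    ultimately obtain k where k: "length p = Suc (Suc k)" "even k"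
      by (intro that[of "2 * (j - 1)"]) auto
    have "last p \<noteq> Tap" using dist start k last by (metis Suc_neq_Zero diff_Suc_1 lessI nth_eq_iff_index_eq zero_less_Suc)
    moreover have "last p \<in> ?V" using pV ne by auto
    ultimately obtain v where v: "{last p, v} \<in> pipes (num_pipes G)" "v \<in> ?V"
    proof (cases "last p")
      case (PipeA i)
      thus ?thesis using \<open>last p \<in> ?V\<close> that[of "PipeB i"]
        by (auto simp: game_vertices_def verticesA0_def verticesA_def verticesB_def pipes_def doubleton_eq_iff)
    next
      case (PipeB i)
      thus ?thesis using \<open>last p \<in> ?V\<close> that[of "PipeA i"]
        by (auto simp: game_vertices_def verticesA0_def verticesA_def verticesB_def pipes_def doubleton_eq_iff)
    qed simp
    hence "v \<in> set p" using stuck by (simp add: game_edges_links)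
    then obtain i where i: "i < length p" "v = p ! i" by (auto simp: in_set_conv_nth)
    have "v \<noteq> last p" using v by (auto simp: pipes_def doubleton_eq_iff)
    hence ik: "i < Suc k" using i k last by (metis diff_Suc_1 less_antisym)
    have "i \<noteq> 0" using v start i by (intro notI) (auto simp: pipes_def doubleton_eq_iff)
    have "{v, last p} \<in> pipes (num_pipes G)" using v by (simp add: insert_commute)
    moreover have "\<exists>j < Suc k. {v, p ! j} \<in> pipes (num_pipes G)"
    proof (cases "even i")
      case True
      then obtain i' where "i = Suc i'" "odd i'" using \<open>i \<noteq> 0\<close> by (cases i) auto
      thus ?thesis using alt[of i'] ik k i by (intro exI[of _ i']) (auto simp: insert_commute)
    next
      case False
      hence "Suc i < Suc k" using ik k(2) by (metis even_Suc less_antisym not_less_eq)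
      thus ?thesis using False alt[of i] k i by (intro exI[of _ "Suc i"]) auto
    qed
    ultimately obtain j where "j < Suc k" "p ! j = last p" using pipes_unique by blast
    thus False using dist last k by (auto simp: nth_eq_iff_index_eq)
  qed
  then obtain m where m: "length p = Suc (2 * m)" by (metis oddE Suc_eq_plus1)
  \<comment> \<open>By maximality a link at the end would lead to a path vertex whose unique link
    goes to a position before the end.\<close>
  have unl: "{p ! (2 * m), v} \<notin> links G x y" for v
  proof
    assume l: "{p ! (2 * m), v} \<in> links G x y"
    have lp: "last p = p ! (2 * m)" using last m by simp
    have l': "{v, last p} \<in> links G x y" using l lp by (simp add: insert_commute)
    have "v \<in> ?V" using l' linksA_vertex[OF G(1,2)] linksB_vertex[OF G(1,3)]
      by (auto simp: links_def game_vertices_def)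
    hence "v \<in> set p" using stuck l lp by (simp add: game_edges_links)
    then obtain i where i: "i < length p" "v = p ! i" by (auto simp: in_set_conv_nth)
    have "v \<noteq> last p"
      using l' links_irrefl[OF G] by blast
    hence i2: "i < 2 * m" using i m lp by (metis less_antisym)
    have "\<exists>j < 2 * m. {v, p ! j} \<in> links G x y"
    proof (cases "even i")
      case True
      hence "Suc i < 2 * m" using i2 by (metis Suc_lessI even_Suc even_mult_iff even_numeral)
      thus ?thesis using True alt[of i] i m by (intro exI[of _ "Suc i"]) auto
    next
      case False
      then obtain i' where "i = Suc i'" "even i'" by (cases i) auto
      thus ?thesis using alt[of i'] i i2 m by (intro exI[of _ i']) (auto simp: insert_commute)
    qed
    then obtain j where "j < 2 * m" "p ! j = last p" using links_unique[OF G l'] by metis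
    thus False using dist lp m by (auto simp: nth_eq_iff_index_eq)
  qed
  have "water_flow n G x y p m"
  proof
    show "{p ! (2 * j), p ! Suc (2 * j)} \<in> links G x y" if "j < m" for j
      using alt[of "2 * j"] that m by simp
    show "{p ! Suc (2 * j), p ! Suc (Suc (2 * j))} \<in> pipes (num_pipes G)" if "j < m" for j
      using alt[of "Suc (2 * j)"] that m by simp
  qed (use G gp start m unl in auto)
  thus ?thesis unfolding p_def by blast
qed

lemma prod_pairs_telescope:
  fixes g :: "nat \<Rightarrow> 'a :: comm_monoid_mult"
  assumes "\<And>j. j < m \<Longrightarrow> g (2 * j) * g (Suc (2 * j)) = 1"
  shows "(\<Prod>i<Suc (2 * m). g i) = g (2 * m)"
  using assms
proof (induction m)
  case (Suc m)
  have "(\<Prod>i<2 * m. g i) * g (2 * m) * g (Suc (2 * m)) = g (2 * m) * g (Suc (2 * m))"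
    using Suc by simp
  hence "(\<Prod>i<2 * m. g i) * (g (2 * m) * g (Suc (2 * m))) = 1" using Suc.prems[of m] by (simp add: mult.assoc)
  hence "(\<Prod>i<2 * m. g i) = 1" using Suc.prems[of m] by simp
  thus ?case using Suc.prems[of m] by (simp add: mult.assoc)
qed simp

lemma prod_pairs_telescope':
  fixes g :: "nat \<Rightarrow> 'a :: comm_monoid_mult"
  assumes "\<And>j. j < m \<Longrightarrow> g (Suc (2 * j)) * g (Suc (Suc (2 * j))) = 1"
  shows "(\<Prod>i<Suc (2 * m). g i) = g 0"
  using assms
proof (induction m)
  case (Suc m)
  thus ?case using Suc.prems[of m] by (simp add: mult.assoc)
qed simp

lemma prod_set_conv_nth:
  assumes "distinct p"
  shows "prod g (set p) = (\<Prod>i<length p. g (p ! i))"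
  using prod.reindex_bij_betw[OF bij_betw_nth[OF assms refl refl], of g] by simp

context water_flow
begin

text \<open>The two ends of each link cancel because \<open>g\<close> squares to 1, and only the end
  of the path is left without a partner. Grouping the product by pipes, as in
  \<open>prod_pipe_constant\<close>, leaves the tap instead.\<close>

lemma prod_link_constant:
  fixes g :: "hose_vertex \<Rightarrow> 'a :: comm_monoid_mult"
  assumes "\<And>v. g v * g v = 1" "\<And>u v. {u, v} \<in> links G x y \<Longrightarrow> g u = g v"
  shows "prod g (set p) = g (last p)"
  unfolding prod_set_conv_nth[OF distinct] len last_path
  using assms(1) assms(2)[OF link_step] by (intro prod_pairs_telescope) simp

lemma prod_pipe_constant:
  fixes g :: "hose_vertex \<Rightarrow> 'a :: comm_monoid_mult"
  assumes "\<And>v. g v * g v = 1" "\<And>u v. {u, v} \<in> pipes (num_pipes G) \<Longrightarrow> g u = g v"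
  shows "prod g (set p) = g Tap"
  unfolding prod_set_conv_nth[OF distinct] len start[symmetric]
  using assms(1) assms(2)[OF pipe_step] by (intro prod_pairs_telescope') simp

end

section \<open>Pauli twirling\<close>

text \<open>The character -1 to the power of the inner product of the bit strings \<open>b\<close>
  and \<open>k\<close>; as a function of \<open>k\<close> it is the diagonal of a string of Pauli Z
  operators.\<close>

definition pauli_sign :: "nat \<Rightarrow> nat \<Rightarrow> nat \<Rightarrow> complex" where
  "pauli_sign N b k = (\<Prod>i<N. if bit b i \<and> bit k i then - 1 else 1)"

lemma pauli_sign_xor_right: "pauli_sign N b (xor k l) = pauli_sign N b k * pauli_sign N b l"
  unfolding pauli_sign_def prod.distrib[symmetric] by (intro prod.cong refl) (auto simp: bit_xor_iff)

lemma pauli_sign_commute: "pauli_sign N b k = pauli_sign N k b"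
  unfolding pauli_sign_def by (intro prod.cong refl) auto

lemma pauli_sign_square: "pauli_sign N b k * pauli_sign N b k = 1"
  unfolding pauli_sign_def prod.distrib[symmetric] by (intro prod.neutral) auto

lemma pauli_sign_cases: "pauli_sign N b k = 1 \<or> pauli_sign N b k = - 1"
  using pauli_sign_square by (simp add: square_eq_1_iff)

lemma cnj_pauli_sign: "cnj (pauli_sign N b k) = pauli_sign N b k"
  unfolding pauli_sign_def cnj_prod by (intro prod.cong refl) auto

lemma xor_less_exp:
  fixes k l :: nat
  shows "k < 2 ^ N \<Longrightarrow> l < 2 ^ N \<Longrightarrow> xor k l < 2 ^ N"
  by (metis take_bit_nat_eq_self_iff take_bit_xor)

lemma sum_xor_shift:
  fixes m :: nat
  assumes "m < 2 ^ N"
  shows "(\<Sum>k<2 ^ N. f (xor k m)) = (\<Sum>k<2 ^ N. f k)"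
  by (rule sum.reindex_bij_witness[of _ "\<lambda>k. xor k m" "\<lambda>k. xor k m"])
    (auto simp: xor_less_exp assms xor.assoc)

lemma not_bit_of_less_exp:
  fixes k :: nat
  assumes "k < 2 ^ N" "N \<le> i"
  shows "\<not> bit k i"
proof -
  have "k < 2 ^ i" using assms by (meson less_le_trans one_le_numeral power_increasing)
  thus ?thesis by (simp add: bit_iff_odd)
qed

text \<open>Orthogonality of characters: flipping in \<open>b\<close> a bit that is set in
  \<open>k\<close> negates every term, so for nonzero \<open>k\<close> the sum equals its own
  negative.\<close>

lemma sum_pauli_sign:
  assumes "k < 2 ^ N"
  shows "(\<Sum>b<2 ^ N. pauli_sign N b k) = (if k = 0 then 2 ^ N else 0)"
proof (cases "k = 0")
  case True
  thus ?thesis by (simp add: pauli_sign_def)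
next
  case False
  then obtain i where "bit k i" by (metis bit_eqI bit_0_eq bot_apply bot_bool_def)
  moreover from this have i: "i < N" using not_bit_of_less_exp[OF assms] by (meson not_le)
  ultimately have "pauli_sign N (2 ^ i) k = (\<Prod>j<N. if j = i then - 1 else 1)"
    unfolding pauli_sign_def by (intro prod.cong refl) (auto simp: bit_exp_iff)
  hence "pauli_sign N k (2 ^ i) = - 1" using i by (simp add: pauli_sign_commute)
  hence flip: "pauli_sign N (xor b (2 ^ i)) k = - pauli_sign N b k" for b
    by (simp add: pauli_sign_commute[of N _ k] pauli_sign_xor_right)
  have "(2::nat) ^ i < 2 ^ N" using i by simp
  from sum_xor_shift[OF this, of "\<lambda>b. pauli_sign N b k"]
  have "(\<Sum>b<2 ^ N. pauli_sign N b k) = 0" by (simp add: flip sum_negf)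
  thus ?thesis using False by simp
qed

text \<open>The Pauli string with shift \<open>a\<close> and phase \<open>b\<close>, followed by the operator with the
  0/1-entries \<open>R\<close>; the prefactor makes the operators for all \<open>a\<close> and \<open>b\<close> complete.\<close>

definition twirl_const :: "nat \<Rightarrow> (nat \<Rightarrow> nat \<Rightarrow> bool) \<Rightarrow> complex" where
  "twirl_const N R = complex_of_real (1 / sqrt (2 ^ N * (\<Sum>k<2 ^ N. \<Sum>l<2 ^ N. of_bool (R k l))))"

definition twirled :: "nat \<Rightarrow> (nat \<Rightarrow> nat \<Rightarrow> bool) \<Rightarrow> nat \<Rightarrow> nat \<Rightarrow> complex mat" where
  "twirled N R a b = mat (2 ^ N) (2 ^ N)
     (\<lambda>(k, l). twirl_const N R * of_bool (R k (xor l a)) * pauli_sign N b l)"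

lemma twirled_carrier: "twirled N R a b \<in> carrier_mat (2 ^ N) (2 ^ N)"
  by (simp add: twirled_def)

text \<open>Summing over the phases \<open>b\<close> kills the entries with
  \<open>i \<noteq> j\<close>. Summing over the shifts \<open>a\<close> then makes the diagonal
  constant, equal to the number of ones of \<open>R\<close>. Together with the factor
  \<open>2 ^ N\<close> from the phases this is the radicand in \<open>twirl_const\<close>.\<close>

lemma twirled_complete:
  assumes R: "R k0 l0" "k0 < 2 ^ N" "l0 < 2 ^ N" and ij: "i < 2 ^ N" "j < 2 ^ N"
  shows "(\<Sum>a<2 ^ N. \<Sum>b<2 ^ N. (mat_adjoint (twirled N R a b) * twirled N R a b) $$ (i, j)) = (if i = j then 1 else 0)"
proof -
  let ?c = "twirl_const N R"
  define B where "B k l = (of_bool (R k l) :: complex)" for k l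
  define S where "S = (\<Sum>k<2 ^ N. \<Sum>l<2 ^ N. of_bool (R k l) :: real)"
  have c: "cnj ?c = ?c" by (simp add: twirl_const_def)
  have B: "cnj (B k l) = B k l" "B k l * B k l = B k l" for k l by (simp_all add: B_def)
  have entry: "(mat_adjoint (twirled N R a b) * twirled N R a b) $$ (i, j) =
      ?c * ?c * (\<Sum>k<2 ^ N. B k (xor i a) * B k (xor j a)) * pauli_sign N b (xor i j)" for a b
    using ij mat_adjoint_carrier[OF twirled_carrier[of N R a b]]
    by (simp add: scalar_prod_def mat_adjoint_index twirled_def atLeast0LessThan cnj_pauli_sign
        pauli_sign_xor_right sum_distrib_left sum_distrib_right c B mult_ac flip: B_def)
  have sum_b: "(\<Sum>b<2 ^ N. (mat_adjoint (twirled N R a b) * twirled N R a b) $$ (i, j)) =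
      ?c * ?c * (\<Sum>k<2 ^ N. B k (xor i a) * B k (xor j a)) * (if i = j then 2 ^ N else 0)" for a
  proof -
    have "xor i j = 0 \<longleftrightarrow> i = j" by (metis xor_self_eq xor.assoc xor.left_neutral xor.right_neutral)
    thus ?thesis unfolding entry sum_distrib_left[symmetric] by (simp add: sum_pauli_sign xor_less_exp ij)
  qed
  have "S \<ge> (\<Sum>l<2 ^ N. of_bool (R k0 l))"
    unfolding S_def using R by (intro member_le_sum) (auto intro: sum_nonneg)
  moreover have "(\<Sum>l<2 ^ N. of_bool (R k0 l) :: real) \<ge> of_bool (R k0 l0)"
    using R by (intro member_le_sum) auto
  \<comment> \<open>If \<open>R\<close> had no ones, \<open>twirl_const\<close> and with it all
    operators would be 0.\<close>
  ultimately have pos: "S > 0" using R by simp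
  show ?thesis
  proof (cases "i = j")
    case True
    have "(\<Sum>a<2 ^ N. \<Sum>k<2 ^ N. B k (xor i a) * B k (xor j a)) = (\<Sum>k<2 ^ N. \<Sum>a<2 ^ N. B k (xor a i))"
      unfolding True by (subst sum.swap) (simp add: xor.commute B)
    also have "\<dots> = complex_of_real S"
      by (simp only: sum_xor_shift[OF ij(1), of "B k" for k]) (simp add: B_def S_def)
    finally have "(\<Sum>a<2 ^ N. \<Sum>b<2 ^ N. (mat_adjoint (twirled N R a b) * twirled N R a b) $$ (i, j)) =
        ?c * ?c * complex_of_real S * 2 ^ N"
      unfolding sum_b using True by (simp only: sum_distrib_left[symmetric] sum_distrib_right[symmetric] if_True refl)
    also have "?c * ?c = complex_of_real (1 / (2 ^ N * S))"
      unfolding twirl_const_def S_def[symmetric] of_real_mult[symmetric] using pos by (simp add: less_imp_le)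
    also have "\<dots> * complex_of_real S * 2 ^ N = complex_of_real (1 / (2 ^ N * S) * S * 2 ^ N)"
      by simp
    also have "1 / (2 ^ N * S) * S * 2 ^ N = 1" using pos by simp
    finally show ?thesis using True by simp
  qed (simp add: sum_b)
qed

text \<open>The message reveals the own input together with the outcome.\<close>

definition twirl_messages :: "nat \<Rightarrow> nat \<Rightarrow> (bool list \<times> nat \<times> nat) set" where
  "twirl_messages n N = bitstrings n \<times> {..<2 ^ N} \<times> {..<2 ^ N}"

definition decode :: "nat \<Rightarrow> nat \<Rightarrow> nat \<Rightarrow> bool list \<times> nat \<times> nat" where
  "decode n N = (SOME h. bij_betw h {0..<card (twirl_messages n N)} (twirl_messages n N))"

text \<open>The set of messages is the same for all inputs; a message that names a different input
  gets the empty list and so has probability 0.\<close>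

definition twirl_instrument ::
    "nat \<Rightarrow> nat \<Rightarrow> (bool list \<Rightarrow> nat \<Rightarrow> nat \<Rightarrow> bool) \<Rightarrow> bool list \<Rightarrow> nat \<Rightarrow> complex mat list" where
  "twirl_instrument n N R x m = (case decode n N m of (x', a, b) \<Rightarrow> if x' = x then [twirled N (R x) a b] else [])"

lemma finite_bitstrings: "finite (bitstrings n)"
  using finite_lists_length_eq[of "UNIV :: bool set" n] by (simp add: bitstrings_def)

lemma bij_decode: "bij_betw (decode n N) {..<card (twirl_messages n N)} (twirl_messages n N)"
proof -
  have "finite (twirl_messages n N)" by (simp add: twirl_messages_def finite_bitstrings)
  thus ?thesis unfolding decode_def atLeast0LessThan
    using someI_ex[OF ex_bij_betw_nat_finite] by (simp add: atLeast0LessThan)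
qed

lemma twirl_instrument_complete:
  assumes x: "x \<in> bitstrings n" and R: "R x k0 l0" "k0 < 2 ^ N" "l0 < 2 ^ N"
  shows "instrument (2 ^ N) (2 ^ N) (card (twirl_messages n N)) (twirl_instrument n N R x)"
  unfolding instrument_def
proof (intro conjI allI impI)
  show "set (twirl_instrument n N R x m) \<subseteq> carrier_mat (2 ^ N) (2 ^ N)" for m
    by (auto simp: twirl_instrument_def twirled_carrier split: prod.split)
  let ?M = "\<lambda>ij a b. (mat_adjoint (twirled N (R x) a b) * twirled N (R x) a b) $$ ij"
  have "(\<Sum>m<card (twirl_messages n N). \<Sum>K\<leftarrow>twirl_instrument n N R x m. (mat_adjoint K * K) $$ ij)
      = (\<Sum>a<2 ^ N. \<Sum>b<2 ^ N. ?M ij a b)" for ij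
  proof -
    have "(\<Sum>m<card (twirl_messages n N). \<Sum>K\<leftarrow>twirl_instrument n N R x m. (mat_adjoint K * K) $$ ij)
      = (\<Sum>m<card (twirl_messages n N). (\<lambda>(x', a, b). if x' = x then ?M ij a b else 0) (decode n N m))"
      by (intro sum.cong refl) (auto simp: twirl_instrument_def split: prod.split)
    also have "\<dots> = (\<Sum>(x', a, b)\<in>twirl_messages n N. if x' = x then ?M ij a b else 0)"
      by (rule sum.reindex_bij_betw[OF bij_decode])
    also have "\<dots> = (\<Sum>x'\<in>bitstrings n. if x' = x then \<Sum>a<2 ^ N. \<Sum>b<2 ^ N. ?M ij a b else 0)"
      unfolding twirl_messages_def sum.cartesian_product[symmetric]
      by (intro sum.cong refl) auto
    finally show ?thesis using x by (simp add: finite_bitstrings)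
  qed
  thus "mat (2 ^ N) (2 ^ N) (\<lambda>ij. \<Sum>m<card (twirl_messages n N). \<Sum>K\<leftarrow>twirl_instrument n N R x m.
      (mat_adjoint K * K) $$ ij) = 1\<^sub>m (2 ^ N)"
    using twirled_complete[of "R x", OF R] by (intro eq_matI) auto
qed

section \<open>Reading out one qubit\<close>

text \<open>Undoes the Pauli operator \<open>X\<^sup>p Z\<^sup>z\<close> on the qubit with index \<open>q\<close>, keeps that qubit and measures all others.\<close>

definition readout_op :: "nat \<Rightarrow> nat \<Rightarrow> bool \<Rightarrow> bool \<Rightarrow> nat \<Rightarrow> complex mat" where
  "readout_op N q p z c = mat 2 (2 ^ N) (\<lambda>(i, k).
     of_bool (bit k q = ((i = 1) \<noteq> p) \<and> unset_bit q k = c) * (if z \<and> i = 1 then - 1 else 1))"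

text \<open>The outcome \<open>c\<close> records the other bits with bit \<open>q\<close> cleared.
  Values of \<open>c\<close> in which bit \<open>q\<close> is set contribute zero operators and keep
  the range of outcomes simple.\<close>

definition readout :: "nat \<Rightarrow> nat \<Rightarrow> bool \<Rightarrow> bool \<Rightarrow> complex mat list" where
  "readout N q p z = map (readout_op N q p z) [0..<2 ^ N]"

lemma readout_op_carrier: "readout_op N q p z c \<in> carrier_mat 2 (2 ^ N)"
  by (simp add: readout_op_def)

lemma unset_bit_less_exp:
  fixes k :: nat
  assumes "k < 2 ^ N"
  shows "unset_bit q k < 2 ^ N"
proof -
  have "take_bit N (unset_bit q k) = unset_bit q k"
    using not_bit_of_less_exp[OF assms] by (intro bit_eqI) (auto simp: bit_simps simp flip: not_le)
  thus ?thesis by (simp add: take_bit_nat_eq_self_iff)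
qed

text \<open>An index is determined by bit \<open>q\<close> and its remaining bits, so each column
  has exactly one nonzero entry among all outcomes, a sign. This covers \<open>q \<ge> N\<close>,
  where the output has the fixed value \<open>p\<close>; such a \<open>q\<close> arises when the
  other player holds the end of the path.\<close>

lemma channel_readout: "channel (2 ^ N) 2 (readout N q p z)"
  unfolding channel_def instrument_def
proof (intro conjI allI impI)
  show "set (readout N q p z) \<subseteq> carrier_mat 2 (2 ^ N)"
    by (auto simp: readout_def readout_op_carrier)
  have entry: "(mat_adjoint (readout_op N q p z c) * readout_op N q p z c) $$ (i, j) =
      (if c = unset_bit q i then if i = j then 1 else 0 else 0)" if ij: "i < 2 ^ N" "j < 2 ^ N" for i j c
  proof -
    have eq: "i = j" if "unset_bit q i = unset_bit q j" "bit i q = bit j q"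
    proof (rule bit_eqI)
      fix m
      have "bit (unset_bit q i) m = bit (unset_bit q j) m" using that by simp
      thus "bit i m = bit j m" using that(2) by (cases "m = q") (simp_all add: bit_unset_bit_iff)
    qed
    let ?L = "\<lambda>o' k. readout_op N q p z c $$ (o', k)"
    have "(mat_adjoint (readout_op N q p z c) * readout_op N q p z c) $$ (i, j) =
        (\<Sum>o'<2. cnj (?L o' i) * ?L o' j)"
      using ij mat_adjoint_carrier[OF readout_op_carrier[of N q p z c]] readout_op_carrier[of N q p z c]
      by (simp add: scalar_prod_def mat_adjoint_index atLeast0LessThan)
    also have "\<dots> = cnj (?L 0 i) * ?L 0 j + cnj (?L 1 i) * ?L 1 j"
      by (simp add: lessThan_nat_numeral lessThan_Suc)
    also have "\<dots> = of_bool (unset_bit q i = c \<and> unset_bit q j = c \<and> bit i q = bit j q)"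
    proof -
      have L: "?L 0 k = of_bool (bit k q = p \<and> unset_bit q k = c)"
        "?L 1 k = of_bool (bit k q \<noteq> p \<and> unset_bit q k = c) * (if z then - 1 else 1)" if "k < 2 ^ N" for k
        using that by (auto simp: readout_op_def)
      show ?thesis unfolding L[OF ij(1)] L[OF ij(2)] by auto
    qed
    also have "\<dots> = (if c = unset_bit q i then if i = j then 1 else 0 else 0)"
    proof (cases "i = j")
      case False
      hence "\<not> (unset_bit q i = c \<and> unset_bit q j = c \<and> bit i q = bit j q)" using eq by metis
      thus ?thesis using False by simp
    qed auto
    finally show ?thesis .
  qed
  have "(\<Sum>K\<leftarrow>readout N q p z. (mat_adjoint K * K) $$ (i, j)) = (if i = j then 1 else 0)"
    if "i < 2 ^ N" "j < 2 ^ N" for i j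
  proof -
    have "(\<Sum>K\<leftarrow>readout N q p z. (mat_adjoint K * K) $$ (i, j))
      = (\<Sum>c<2 ^ N. (mat_adjoint (readout_op N q p z c) * readout_op N q p z c) $$ (i, j))"
      by (simp add: readout_def o_def interv_sum_list_conv_sum_set_nat atLeast0LessThan)
    also have "\<dots> = (\<Sum>c<2 ^ N. if c = unset_bit q i then if i = j then 1 else 0 else 0)"
      using entry[OF that] by simp
    finally show ?thesis using that by (simp add: unset_bit_less_exp)
  qed
  thus "mat (2 ^ N) (2 ^ N) (\<lambda>ij. \<Sum>m<(1::nat). \<Sum>K\<leftarrow>readout N q p z. (mat_adjoint K * K) $$ ij) = 1\<^sub>m (2 ^ N)"
    by (intro eq_matI) auto
qed

section \<open>EPR pairs\<close>

lemma bit_mult_exp_add: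
  fixes k q :: nat
  assumes "k < 2 ^ s"
  shows "bit (q * 2 ^ s + k) i \<longleftrightarrow> (if i < s then bit k i else bit q (i - s))"
proof -
  have "and (push_bit s q) k = 0"
    using not_bit_of_less_exp[OF assms] by (intro bit_eqI) (auto simp: bit_simps)
  from disjunctive_add_eq_or[OF this] have "q * 2 ^ s + k = or (push_bit s q) k"
    by (simp add: push_bit_eq_mult)
  thus ?thesis using not_bit_of_less_exp[OF assms] by (auto simp: bit_simps)
qed

lemma bit_of_eq_bit: "bit_of i a = of_bool (bit a i)"
  by (simp add: bit_of_def bit_iff_odd mod_2_eq_odd)

text \<open>Each pair forces equal bits on both sides. The value of \<open>epr_pair $ 0\<close>
  stays symbolic, since it matters only for the norm.\<close>

lemma epr_vec_index:
  assumes "a < 2 ^ s" "b < 2 ^ s"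
  shows "epr_vec s $ (a * 2 ^ s + b) = (if a = b then epr_pair $ 0 ^ s else 0)"
proof -
  have pair: "epr_pair $ (2 * of_bool u + of_bool v) = (if u = v then epr_pair $ 0 else 0)" for u v
    by (simp add: epr_pair_def numeral_2_eq_2 numeral_3_eq_3)
  have "epr_vec s $ (a * 2 ^ s + b) = (\<Prod>i<s. if bit a i = bit b i then epr_pair $ 0 else 0)"
    using assms mult_add_less[OF assms] by (simp add: epr_vec_def bit_of_eq_bit pair)
  also have "\<dots> = (if a = b then epr_pair $ 0 ^ s else 0)"
  proof (cases "a = b")
    case False
    then obtain i where i: "bit a i \<noteq> bit b i" by (metis bit_eqI)
    hence "i < s" using not_bit_of_less_exp assms by (metis not_le)
    thus ?thesis using i False by (auto intro!: prod_zero)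
  qed simp
  finally show ?thesis .
qed

lemma epr_vec_norm: "(\<Sum>l<2 ^ s * 2 ^ s. epr_vec s $ l * cnj (epr_vec s $ l)) = 1"
proof -
  have half: "epr_pair $ 0 * cnj (epr_pair $ 0) = 1 / 2"
    by (simp add: epr_pair_def flip: of_real_mult)
  have "(\<Sum>l<2 ^ s * 2 ^ s. epr_vec s $ l * cnj (epr_vec s $ l))
    = (\<Sum>a<(2::nat) ^ s. \<Sum>b<2 ^ s. if b = a then epr_pair $ 0 ^ s * cnj (epr_pair $ 0 ^ s) else 0)"
    unfolding sum_lessThan_mult_split by (intro sum.cong refl) (simp add: epr_vec_index)
  also have "\<dots> = 2 ^ s * (epr_pair $ 0 * cnj (epr_pair $ 0)) ^ s"
    by (simp add: power_mult_distrib)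
  also have "\<dots> = 1" unfolding half by (simp flip: power_mult_distrib)
  finally show ?thesis .
qed

lemma density_operator_pure:
  assumes "(\<Sum>l<d. \<eta> l * cnj (\<eta> l)) = (1 :: complex)"
  shows "density_operator d (mat d d (\<lambda>(i, j). \<eta> i * cnj (\<eta> j)))" (is "density_operator d ?\<rho>")
  unfolding density_operator_def
proof (intro conjI ballI)
  have nonneg: "0 \<le> z * cnj z" for z :: complex
    by (simp add: less_eq_complex_def)
  fix v :: "complex vec" assume v: "v \<in> carrier_vec d"
  have "(?\<rho> *\<^sub>v v) \<bullet>c v = (\<Sum>i<d. (\<Sum>j<d. \<eta> i * cnj (\<eta> j) * v $ j) * cnj (v $ i))"
    using v by (simp add: scalar_prod_def atLeast0LessThan)
  also have "\<dots> = (\<Sum>i<d. \<Sum>j<d. (\<eta> i * cnj (v $ i)) * cnj (\<eta> j * cnj (v $ j)))"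
    by (simp add: sum_distrib_left sum_distrib_right mult_ac)
  also have "\<dots> = (\<Sum>i<d. \<eta> i * cnj (v $ i)) * cnj (\<Sum>i<d. \<eta> i * cnj (v $ i))"
    by (simp only: cnj_sum sum_product)
  also have "\<dots> \<ge> 0" by (rule nonneg)
  finally show "0 \<le> (?\<rho> *\<^sub>v v) \<bullet>c v" .
qed (use assms in auto)

lemma density_operator_epr: "density_operator (2 ^ s * 2 ^ s) (epr_state s)"
  unfolding epr_state_def by (rule density_operator_pure[OF epr_vec_norm])

text \<open>The EPR vector identifies the indices of the two shares, so a single string
  \<open>k\<close> describes the bits in all pipes.\<close>

lemma amplitude_epr:
  assumes K: "K \<in> carrier_mat (2 ^ Suc s) (2 ^ Suc s)" "K' \<in> carrier_mat (2 ^ s) (2 ^ s)"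
    and L: "L \<in> carrier_mat 2 (2 ^ Suc s)" "L' \<in> carrier_mat 2 (2 ^ s)"
    and i: "i < 2" "i' < 2" and q: "q < 2"
  shows "amplitude (($) (epr_vec s)) (2 ^ s * 2 ^ s) (kron L L') (kron K K') (i * 2 + i') q =
    epr_pair $ 0 ^ s * (\<Sum>g<2 ^ Suc s. \<Sum>h<2 ^ s. \<Sum>k<2 ^ s.
      L $$ (i, g) * L' $$ (i', h) * K $$ (g, q * 2 ^ s + k) * K' $$ (h, k))"
proof -
  let ?c = "epr_pair $ 0 ^ s"
  have inner: "(\<Sum>l<2 ^ s * 2 ^ s. kron K K' $$ (g * 2 ^ s + h, q * (2 ^ s * 2 ^ s) + l) * epr_vec s $ l)
    = (\<Sum>k<2 ^ s. K $$ (g, q * 2 ^ s + k) * K' $$ (h, k) * ?c)" (is "?lhs = _")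
    if "g < 2 ^ Suc s" "h < 2 ^ s" for g h
  proof -
    have eq: "q * (2 ^ s * 2 ^ s) + (a * 2 ^ s + b) = (q * 2 ^ s + a) * 2 ^ s + b" for a b :: nat
      by (simp add: algebra_simps)
    have "?lhs = (\<Sum>a<2 ^ s. \<Sum>b<2 ^ s. if b = a then K $$ (g, q * 2 ^ s + a) * K' $$ (h, b) * ?c else 0)"
      unfolding sum_lessThan_mult_split
    proof (intro sum.cong refl)
      fix a b :: nat assume ab: "a \<in> {..<2 ^ s}" "b \<in> {..<2 ^ s}"
      have "q * 2 ^ s + a < 2 ^ Suc s" using mult_add_less[OF q, of a "2 ^ s"] ab by simp
      thus "kron K K' $$ (g * 2 ^ s + h, q * (2 ^ s * 2 ^ s) + (a * 2 ^ s + b)) * epr_vec s $ (a * 2 ^ s + b)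
        = (if b = a then K $$ (g, q * 2 ^ s + a) * K' $$ (h, b) * ?c else 0)"
        unfolding eq using ab that by (subst kron_index[OF K]) (auto simp: epr_vec_index)
    qed
    thus ?thesis by simp
  qed
  have "dim_col (kron L L') = 2 ^ Suc s * 2 ^ s" using kron_carrier[OF L] by auto
  hence "amplitude (($) (epr_vec s)) (2 ^ s * 2 ^ s) (kron L L') (kron K K') (i * 2 + i') q =
    (\<Sum>g<2 ^ Suc s. \<Sum>h<2 ^ s. kron L L' $$ (i * 2 + i', g * 2 ^ s + h) *
      (\<Sum>l<2 ^ s * 2 ^ s. kron K K' $$ (g * 2 ^ s + h, q * (2 ^ s * 2 ^ s) + l) * epr_vec s $ l))"
    by (simp only: amplitude_def sum_lessThan_mult_split[of _ "2 ^ Suc s"])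
  also have "\<dots> = (\<Sum>g<2 ^ Suc s. \<Sum>h<2 ^ s. L $$ (i, g) * L' $$ (i', h) *
      (\<Sum>k<2 ^ s. K $$ (g, q * 2 ^ s + k) * K' $$ (h, k) * ?c))"
  proof (intro sum.cong refl)
    fix g h :: nat assume gh: "g \<in> {..<2 ^ Suc s}" "h \<in> {..<2 ^ s}"
    hence "kron L L' $$ (i * 2 + i', g * 2 ^ s + h) = L $$ (i, g) * L' $$ (i', h)"
      using i by (intro kron_index[OF L]) auto
    thus "kron L L' $$ (i * 2 + i', g * 2 ^ s + h) *
      (\<Sum>l<2 ^ s * 2 ^ s. kron K K' $$ (g * 2 ^ s + h, q * (2 ^ s * 2 ^ s) + l) * epr_vec s $ l)
      = L $$ (i, g) * L' $$ (i', h) * (\<Sum>k<2 ^ s. K $$ (g, q * 2 ^ s + k) * K' $$ (h, k) * ?c)"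
      using gh by (simp only: inner lessThan_iff)
  qed
  finally show ?thesis by (simp only: sum_distrib_left mult_ac)
qed

section \<open>Teleporting through the pipes\<close>

text \<open>Alice's qubits are numbered so that the unknown qubit is the most significant one, which is
  the order in which her laboratory holds them.\<close>

definition vertex_pos :: "nat \<Rightarrow> hose_vertex \<Rightarrow> nat" where
  "vertex_pos s v = (case v of Tap \<Rightarrow> s | PipeA i \<Rightarrow> i - 1 | PipeB i \<Rightarrow> i - 1)"

text \<open>The support of the unnormalised Kraus operator (output \<open>k\<close>, input \<open>l\<close>) that applies the Bell functional
  \<open>\<langle>00| + \<langle>11|\<close> to every linked pair and keeps the other qubits. The measured qubits are replaced by
  \<open>|0\<rangle> + |1\<rangle>\<close>, so that input and output have the same dimension.\<close>

definition bell_rel :: "nat \<Rightarrow> hose_vertex set \<Rightarrow> hose_vertex set set \<Rightarrow> nat \<Rightarrow> nat \<Rightarrow> bool" where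
  "bell_rel s V E k l \<longleftrightarrow>
     (\<forall>u v. {u, v} \<in> E \<longrightarrow> bit l (vertex_pos s u) = bit l (vertex_pos s v)) \<and>
     (\<forall>v\<in>V. (\<forall>u. {v, u} \<notin> E) \<longrightarrow> bit k (vertex_pos s v) = bit l (vertex_pos s v))"

definition vertex_bit :: "nat \<Rightarrow> nat \<Rightarrow> nat \<Rightarrow> hose_vertex \<Rightarrow> bool" where
  "vertex_bit s a b v = (case v of Tap \<Rightarrow> bit a s | PipeA i \<Rightarrow> bit a (i - 1) | PipeB i \<Rightarrow> bit b (i - 1))"

text \<open>As signs, bits are multiplied where they would be added modulo 2, so parities along the
  path become products that telescope.\<close>

definition vertex_sign :: "nat \<Rightarrow> nat \<Rightarrow> nat \<Rightarrow> hose_vertex \<Rightarrow> int" where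
  "vertex_sign s a b v = (if vertex_bit s a b v then - 1 else 1)"

text \<open>Indicator string of Alice's vertices in \<open>U\<close>, in the numbering of
  \<open>vertex_pos\<close>: the tap is bit \<open>s\<close>, and pipe \<open>i\<close> is bit
  \<open>i - 1\<close>.\<close>

definition maskA :: "nat \<Rightarrow> hose_vertex set \<Rightarrow> nat" where
  "maskA s U = horner_sum of_bool 2 (map (\<lambda>i. (if i = s then Tap else PipeA (Suc i)) \<in> U) [0..<Suc s])"

definition maskB :: "nat \<Rightarrow> hose_vertex set \<Rightarrow> nat" where
  "maskB s U = horner_sum of_bool 2 (map (\<lambda>i. PipeB (Suc i) \<in> U) [0..<s])"

lemma bit_maskA_iff: "bit (maskA s U) i \<longleftrightarrow> i < Suc s \<and> (if i = s then Tap else PipeA (Suc i)) \<in> U"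
proof (cases "i < Suc s")
  case True
  thus ?thesis unfolding maskA_def bit_horner_sum_bit_iff by (simp del: upt_Suc)
next
  case False
  thus ?thesis unfolding maskA_def bit_horner_sum_bit_iff by (simp del: upt_Suc)
qed

lemma bit_maskB_iff: "bit (maskB s U) i \<longleftrightarrow> i < s \<and> PipeB (Suc i) \<in> U"
proof (cases "i < s")
  case True
  thus ?thesis unfolding maskB_def bit_horner_sum_bit_iff by simp
next
  case False
  thus ?thesis unfolding maskB_def bit_horner_sum_bit_iff by simp
qed

lemma maskA_less: "maskA s U < 2 ^ Suc s"
  using horner_sum_of_bool_2_less[of "map (\<lambda>i. (if i = s then Tap else PipeA (Suc i)) \<in> U) [0..<Suc s]"]
  unfolding maskA_def length_map length_upt diff_zero .

lemma maskB_less: "maskB s U < 2 ^ s"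
  using horner_sum_of_bool_2_less[of "map (\<lambda>i. PipeB (Suc i) \<in> U) [0..<s]"]
  unfolding maskB_def length_map length_upt diff_zero .

lemma bit_maskA_vertex: "v \<in> verticesA0 s \<Longrightarrow> bit (maskA s U) (vertex_pos s v) \<longleftrightarrow> v \<in> U"
  by (auto simp: bit_maskA_iff verticesA0_def verticesA_def vertex_pos_def)

lemma bit_maskB_vertex: "v \<in> verticesB s \<Longrightarrow> bit (maskB s U) (vertex_pos s v) \<longleftrightarrow> v \<in> U"
  by (auto simp: bit_maskB_iff verticesB_def vertex_pos_def)

lemma vertex_bit_A: "v \<in> verticesA0 s \<Longrightarrow> vertex_bit s a b v = bit a (vertex_pos s v)"
  by (auto simp: vertex_bit_def verticesA0_def verticesA_def vertex_pos_def)

lemma vertex_bit_B: "v \<in> verticesB s \<Longrightarrow> vertex_bit s a b v = bit b (vertex_pos s v)"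
  by (auto simp: vertex_bit_def verticesB_def vertex_pos_def)

lemma vertex_sign_xor: "vertex_sign s (xor a a') (xor b b') v = vertex_sign s a b v * vertex_sign s a' b' v"
  by (auto simp: vertex_sign_def vertex_bit_def bit_xor_iff split: hose_vertex.split)

lemma vertex_sign_square: "vertex_sign s a b v * vertex_sign s a b v = 1"
  by (simp add: vertex_sign_def)

text \<open>The relation only compares pairs of bits, and the members of each pair flip together:
  \<open>W\<close> contains both ends of a link or neither, and an unlinked vertex lies in
  \<open>W\<close> exactly if it is \<open>e\<close>, where the output flips as well.\<close>

lemma bell_rel_flip:
  assumes V: "\<And>v. v \<in> V \<Longrightarrow> bit m (vertex_pos s v) \<longleftrightarrow> v \<in> W"
      "\<And>v. v \<in> V \<Longrightarrow> bit m' (vertex_pos s v) \<longleftrightarrow> v = e"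
    and E: "\<And>u v. {u, v} \<in> E \<Longrightarrow> u \<in> V" "\<And>u v. {u, v} \<in> E \<Longrightarrow> u \<in> W \<Longrightarrow> v \<in> W"
    and e: "\<And>v. v \<in> V \<Longrightarrow> \<forall>u. {v, u} \<notin> E \<Longrightarrow> v \<in> W \<longleftrightarrow> v = e"
  shows "bell_rel s V E (xor k m') (xor l m) \<longleftrightarrow> bell_rel s V E k l"
proof -
  have "bit m (vertex_pos s u) \<longleftrightarrow> bit m (vertex_pos s v)" if "{u, v} \<in> E" for u v
  proof -
    have "{v, u} \<in> E" using that by (simp add: insert_commute)
    hence "u \<in> V" "v \<in> V" "u \<in> W \<longleftrightarrow> v \<in> W" using that E by blast+
    thus ?thesis using V(1) by simp
  qed
  hence "(\<forall>u v. {u, v} \<in> E \<longrightarrow> (bit l (vertex_pos s u) \<noteq> bit m (vertex_pos s u)) = (bit l (vertex_pos s v) \<noteq> bit m (vertex_pos s v)))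
      \<longleftrightarrow> (\<forall>u v. {u, v} \<in> E \<longrightarrow> bit l (vertex_pos s u) = bit l (vertex_pos s v))" by blast
  moreover have "bit m (vertex_pos s v) \<longleftrightarrow> bit m' (vertex_pos s v)" if "v \<in> V" "\<forall>u. {v, u} \<notin> E" for v
    using V[OF that(1)] e[OF that] by simp
  hence "(\<forall>v\<in>V. (\<forall>u. {v, u} \<notin> E) \<longrightarrow> (bit k (vertex_pos s v) \<noteq> bit m' (vertex_pos s v)) = (bit l (vertex_pos s v) \<noteq> bit m (vertex_pos s v)))
      \<longleftrightarrow> (\<forall>v\<in>V. (\<forall>u. {v, u} \<notin> E) \<longrightarrow> bit k (vertex_pos s v) = bit l (vertex_pos s v))" by blast
  ultimately show ?thesis unfolding bell_rel_def bit_xor_iff by simp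
qed

lemma bell_rel_linked: "bell_rel s V E k l \<Longrightarrow> {u, v} \<in> E \<Longrightarrow> bit l (vertex_pos s u) = bit l (vertex_pos s v)"
  by (simp add: bell_rel_def)

lemma bell_rel_unlinked:
  "bell_rel s V E k l \<Longrightarrow> v \<in> V \<Longrightarrow> (\<And>u. {v, u} \<notin> E) \<Longrightarrow> bit k (vertex_pos s v) = bit l (vertex_pos s v)"
  by (simp add: bell_rel_def)

text \<open>The accumulated shift error, as a sign. Its counterpart \<open>flow_phase\<close> is the
  accumulated phase error; it is complex because it multiplies amplitudes, and its string arguments
  are phases instead of shifts.\<close>

definition flow_sign :: "nat \<Rightarrow> hose_vertex set \<Rightarrow> nat \<Rightarrow> nat \<Rightarrow> int" where
  "flow_sign s W a b = (\<Prod>v\<in>W. vertex_sign s a b v)"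

definition flow_phase :: "nat \<Rightarrow> hose_vertex set \<Rightarrow> nat \<Rightarrow> nat \<Rightarrow> complex" where
  "flow_phase s W a b = pauli_sign (Suc s) a (maskA s W) * pauli_sign s b (maskB s W)"

text \<open>Both players follow the same recipe, each on the own \<open>N\<close> qubits. It
  recovers the unknown qubit for the player on whose side the path ends; the output of the other is
  traced out.\<close>

definition correct :: "hose_game \<Rightarrow> nat \<Rightarrow> bool list \<times> nat \<times> nat \<Rightarrow> bool list \<times> nat \<times> nat \<Rightarrow> complex mat list" where
  "correct G N = (\<lambda>(x, a, b) (y, a', b'). let p = water_path G x y; s = num_pipes G in
     readout N (vertex_pos s (last p)) (flow_sign s (set p) a a' = - 1) (flow_phase s (set p) b b' = - 1))"

definition hose_attack :: "nat \<Rightarrow> hose_game \<Rightarrow> attack" where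
  "hose_attack n G = (let s = num_pipes G in
    \<lparr> resA = 2 ^ s, resB = 2 ^ s, shared = epr_state s, memA = 2 ^ Suc s, memB = 2 ^ s,
      msgsA = card (twirl_messages n (Suc s)), msgsB = card (twirl_messages n s),
      firstA = twirl_instrument n (Suc s) (\<lambda>x. bell_rel s (verticesA0 s) (linksA G x)),
      firstB = twirl_instrument n s (\<lambda>y. bell_rel s (verticesB s) (linksB G y)),
      secondA = (\<lambda>x a b. correct G (Suc s) (decode n (Suc s) a) (decode n s b)),
      secondB = (\<lambda>y a b. correct G s (decode n (Suc s) a) (decode n s b)) \<rparr>)"

section \<open>Validity of the hose attack\<close>

lemma shares_epr_pairs_hose_attack: "shares_epr_pairs (num_pipes G) (hose_attack n G)"
  by (simp add: shares_epr_pairs_def hose_attack_def Let_def)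

lemma channel_correct: "channel (2 ^ N) 2 (correct G N m m')"
  by (simp add: correct_def channel_readout Let_def split: prod.split)

lemma valid_hose_attack: "valid_attack n (hose_attack n G)"
proof -
  let ?s = "num_pipes G"
  \<comment> \<open>The all-zero strings satisfy every equality of bits, so the operator to be
    twirled is nonzero for any links.\<close>
  have 0: "bell_rel s V E 0 0" for s V E by (simp add: bell_rel_def)
  have "instrument (2 ^ Suc ?s) (2 ^ Suc ?s) (card (twirl_messages n (Suc ?s)))
      (twirl_instrument n (Suc ?s) (\<lambda>x. bell_rel ?s (verticesA0 ?s) (linksA G x)) x)" if "x \<in> bitstrings n" for x
    using that 0 by (rule twirl_instrument_complete) auto
  moreover have "instrument (2 ^ ?s) (2 ^ ?s) (card (twirl_messages n ?s))
      (twirl_instrument n ?s (\<lambda>y. bell_rel ?s (verticesB ?s) (linksB G y)) y)" if "y \<in> bitstrings n" for y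
    using that 0 by (rule twirl_instrument_complete) auto
  ultimately show ?thesis
    using channel_correct[of "Suc ?s"] channel_correct[of ?s] density_operator_epr[of ?s]
    by (simp add: valid_attack_def hose_attack_def Let_def)
qed

lemma pure_attack_hose:
  assumes "x \<in> bitstrings n" "y \<in> bitstrings n"
  shows "pure_attack n (hose_attack n G) (($) (epr_vec (num_pipes G))) (2 ^ num_pipes G * 2 ^ num_pipes G) x y"
  using assms valid_hose_attack
  by unfold_locales (auto simp: hose_attack_def Let_def epr_state_def)

section \<open>Shifts and phases along the water path\<close>

context water_flow
begin

abbreviation s where "s \<equiv> num_pipes G"
abbreviation W where "W \<equiv> set p"
abbreviation e where "e \<equiv> last p"

lemma path_nonempty: "p \<noteq> []"
  using len by auto

lemma start_in_path: "Tap \<in> W"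
  using start len by (metis nth_mem zero_less_Suc)

lemma end_not_linked: "{e, v} \<notin> links G x y"
  using end_unlinked last_path by simp

lemma end_in_path: "e \<in> W"
  using path_nonempty by simp

lemma unlinked_iff:
  assumes "\<And>u. {v, u} \<notin> links G x y"
  shows "v \<in> W \<longleftrightarrow> v = e"
  using linked assms end_in_path by metis

lemma linksA_flip:
  "bell_rel s (verticesA0 s) (linksA G x) (xor k (maskA s {e})) (xor l (maskA s W))
    \<longleftrightarrow> bell_rel s (verticesA0 s) (linksA G x) k l"
proof (rule bell_rel_flip[of _ _ _ W _ e])
  fix v assume v: "v \<in> verticesA0 s" "\<forall>u. {v, u} \<notin> linksA G x"
  hence "{v, u} \<notin> links G x y" for u
    using linksB_vertex[OF G y, of v u] verticesA0_not_B[of v s] by (auto simp: links_def)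
  thus "v \<in> W \<longleftrightarrow> v = e" by (rule unlinked_iff)
qed (auto simp: bit_maskA_vertex linksA_vertex[OF G x] intro: link_closed simp: links_def)

lemma linksB_flip:
  "bell_rel s (verticesB s) (linksB G y) (xor k (maskB s {e})) (xor l (maskB s W))
    \<longleftrightarrow> bell_rel s (verticesB s) (linksB G y) k l"
proof (rule bell_rel_flip[of _ _ _ W _ e])
  fix v assume v: "v \<in> verticesB s" "\<forall>u. {v, u} \<notin> linksB G y"
  hence "{v, u} \<notin> links G x y" for u
    using linksA_vertex[OF G x, of v u] verticesA0_not_B[of v s] by (auto simp: links_def)
  thus "v \<in> W \<longleftrightarrow> v = e" by (rule unlinked_iff)
qed (auto simp: bit_maskB_vertex linksB_vertex[OF G y] intro: link_closed simp: links_def)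

lemma pipe_in_path_iff:
  assumes "1 \<le> i" "i \<le> s"
  shows "PipeA i \<in> W \<longleftrightarrow> PipeB i \<in> W"
proof -
  have "{PipeA i, PipeB i} \<in> pipes s" using assms by (auto simp: pipes_def)
  thus ?thesis using pipe_closed by (metis insert_commute)
qed

text \<open>Alice's mask consists of the bit of the unknown qubit and of Bob's mask.\<close>

lemma xor_maskA:
  assumes "k < 2 ^ s"
  shows "xor (0 * 2 ^ s + k) (maskA s W) = 1 * 2 ^ s + xor k (maskB s W)"
proof (rule bit_eqI)
  fix i
  have "xor k (maskB s W) < 2 ^ s" by (rule xor_less_exp[OF assms maskB_less])
  thus "bit (xor (0 * 2 ^ s + k) (maskA s W)) i \<longleftrightarrow> bit (1 * 2 ^ s + xor k (maskB s W)) i"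
    unfolding bit_xor_iff bit_mult_exp_add[OF assms] bit_mult_exp_add[OF \<open>xor k (maskB s W) < 2 ^ s\<close>]
    using pipe_in_path_iff[of "Suc i"] start_in_path
    by (auto simp: bit_maskA_iff bit_maskB_iff bit_Suc_0_iff)
qed

text \<open>One product over the path is grouped in two ways. By links, the bits after the shifts
  leave the bit at the end; by pipes, the bits before the shifts leave the bit of the tap, which is
  \<open>q\<close>. The two differ by the product of the shifts.\<close>

lemma flow_value:
  assumes A: "bell_rel s (verticesA0 s) (linksA G x) g (xor (q * 2 ^ s + k) a)"
    and B: "bell_rel s (verticesB s) (linksB G y) h (xor k a')"
    and k: "k < 2 ^ s" and q: "q < 2"
  shows "vertex_bit s g h e \<longleftrightarrow> (q = 1) \<noteq> (flow_sign s W a a' = - 1)"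
proof -
  let ?g = "xor (q * 2 ^ s + k) a" and ?h = "xor k a'"
  have "vertex_sign s ?g ?h u = vertex_sign s ?g ?h v" if link: "{u, v} \<in> links G x y" for u v
  proof -
    consider "{u, v} \<in> linksA G x" | "{u, v} \<in> linksB G y" using link by (auto simp: links_def)
    thus ?thesis
    proof cases
      case 1
      hence "u \<in> verticesA0 s" "v \<in> verticesA0 s"
        using linksA_vertex[OF G x] linksA_vertex[OF G x, of v u] by (simp_all add: insert_commute)
      thus ?thesis using bell_rel_linked[OF A 1] by (simp add: vertex_sign_def vertex_bit_A)
    next
      case 2
      hence "u \<in> verticesB s" "v \<in> verticesB s"
        using linksB_vertex[OF G y] linksB_vertex[OF G y, of v u] by (simp_all add: insert_commute)
      thus ?thesis using bell_rel_linked[OF B 2] by (simp add: vertex_sign_def vertex_bit_B)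
    qed
  qed
  from prod_link_constant[OF vertex_sign_square this]
  have "vertex_sign s ?g ?h e = flow_sign s W ?g ?h" by (simp add: flow_sign_def)
  also have "\<dots> = flow_sign s W (q * 2 ^ s + k) k * flow_sign s W a a'"
    by (simp add: flow_sign_def vertex_sign_xor prod.distrib)
  also have "flow_sign s W (q * 2 ^ s + k) k = vertex_sign s (q * 2 ^ s + k) k Tap"
    unfolding flow_sign_def
  proof (rule prod_pipe_constant[OF vertex_sign_square])
    fix u v assume "{u, v} \<in> pipes s"
    then obtain i where i: "1 \<le> i" "i \<le> s" "u = PipeA i \<and> v = PipeB i \<or> u = PipeB i \<and> v = PipeA i"
      by (auto simp: pipes_def doubleton_eq_iff)
    have "i - 1 < s" using i(1,2) by linarith
    thus "vertex_sign s (q * 2 ^ s + k) k u = vertex_sign s (q * 2 ^ s + k) k v"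
      using i(3) by (auto simp: vertex_sign_def vertex_bit_def bit_mult_exp_add[OF k])
  qed
  also have "\<dots> = (if q = 1 then - 1 else 1)"
    using q by (auto simp: vertex_sign_def vertex_bit_def bit_mult_exp_add[OF k] less_2_cases_iff bit_Suc_0_iff)
  finally have "vertex_sign s ?g ?h e = (if q = 1 then - 1 else 1) * flow_sign s W a a'" .
  moreover have "flow_sign s W a a' = 1 \<or> flow_sign s W a a' = - 1"
  proof -
    have "flow_sign s W a a' * flow_sign s W a a' = 1"
      unfolding flow_sign_def prod.distrib[symmetric] vertex_sign_square by simp
    thus ?thesis by (simp add: square_eq_1_iff)
  qed
  ultimately have "vertex_bit s ?g ?h e \<longleftrightarrow> (q = 1) \<noteq> (flow_sign s W a a' = - 1)"
    by (auto simp: vertex_sign_def split: if_splits)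
  \<comment> \<open>The end is unlinked and therefore not measured: its output bit is its shifted
    input bit.\<close>
  moreover have "vertex_bit s g h e \<longleftrightarrow> vertex_bit s ?g ?h e"
  proof -
    have "e \<in> verticesA0 s \<union> verticesB s"
      using vertices end_in_path by (auto simp: game_vertices_def)
    moreover have "{e, v} \<notin> linksA G x" "{e, v} \<notin> linksB G y" for v
      using end_not_linked[of v] by (simp_all add: links_def)
    ultimately show ?thesis
      using bell_rel_unlinked[OF A, of e] bell_rel_unlinked[OF B, of e]
      by (auto simp: vertex_bit_A vertex_bit_B)
  qed
  ultimately show ?thesis by simp
qed

text \<open>The amplitude of the pair of message contents \<open>(a, b)\<close> and \<open>(a', b')\<close>, of the bit \<open>q\<close> of the
  unknown qubit and of the outcome \<open>k\<close> of the EPR pairs.\<close>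

definition branch_weight :: "nat \<Rightarrow> nat \<Rightarrow> nat \<Rightarrow> nat \<Rightarrow> nat \<Rightarrow> nat \<Rightarrow> nat \<Rightarrow> nat \<Rightarrow> complex" where
  "branch_weight a b a' b' g h q k =
     twirled (Suc s) (bell_rel s (verticesA0 s) (linksA G x)) a b $$ (g, q * 2 ^ s + k) *
     twirled s (bell_rel s (verticesB s) (linksB G y)) a' b' $$ (h, k)"

lemma Alice_index:
  fixes k q :: nat
  shows "k < 2 ^ s \<Longrightarrow> q < 2 \<Longrightarrow> q * 2 ^ s + k < 2 ^ Suc s"
  using mult_add_less[of q 2 k "2 ^ s"] by simp

lemma branch_weight_flow:
  assumes "branch_weight a b a' b' g h q k \<noteq> 0" "g < 2 ^ Suc s" "h < 2 ^ s" "k < 2 ^ s" "q < 2"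
  shows "vertex_bit s g h e \<longleftrightarrow> (q = 1) \<noteq> (flow_sign s W a a' = - 1)"
proof (rule flow_value)
  show "bell_rel s (verticesA0 s) (linksA G x) g (xor (q * 2 ^ s + k) a)"
    using assms Alice_index[OF assms(4,5)] by (simp add: branch_weight_def twirled_def)
  show "bell_rel s (verticesB s) (linksB G y) h (xor k a')"
    using assms by (simp add: branch_weight_def twirled_def)
qed (use assms in auto)

text \<open>Flipping the path preserves the 0/1-entries. The tap is on the path, so \<open>q\<close>
  changes from 0 to 1, and the phase signs, being characters, contribute their values at the masks
  of the path.\<close>

lemma branch_weight_flip:
  assumes "g < 2 ^ Suc s" "h < 2 ^ s" "k < 2 ^ s"
  shows "branch_weight a b a' b' (xor g (maskA s {e})) (xor h (maskB s {e})) 1 (xor k (maskB s W))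
    = flow_phase s W b b' * branch_weight a b a' b' g h 0 k"
proof -
  have less: "xor g (maskA s {e}) < 2 ^ Suc s" "xor h (maskB s {e}) < 2 ^ s" "xor k (maskB s W) < 2 ^ s"
    using assms maskA_less maskB_less by (blast intro: xor_less_exp)+
  have A: "twirled (Suc s) (bell_rel s (verticesA0 s) (linksA G x)) a b
      $$ (xor g (maskA s {e}), 1 * 2 ^ s + xor k (maskB s W))
    = pauli_sign (Suc s) b (maskA s W) * twirled (Suc s) (bell_rel s (verticesA0 s) (linksA G x)) a b $$ (g, 0 * 2 ^ s + k)"
  proof -
    have "1 * 2 ^ s + xor k (maskB s W) < 2 ^ Suc s" "0 * 2 ^ s + k < 2 ^ Suc s"
      using Alice_index[OF less(3), of 1] Alice_index[OF assms(3), of 0] by simp_all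
    moreover have "xor (1 * 2 ^ s + xor k (maskB s W)) a = xor (xor (0 * 2 ^ s + k) a) (maskA s W)"
      unfolding xor_maskA[OF assms(3), symmetric] by (simp add: ac_simps)
    ultimately show ?thesis using less assms
      by (simp only: twirled_def index_mat prod.case linksA_flip)
        (simp only: xor_maskA[OF assms(3), symmetric] pauli_sign_xor_right mult_ac)
  qed
  have B: "twirled s (bell_rel s (verticesB s) (linksB G y)) a' b' $$ (xor h (maskB s {e}), xor k (maskB s W))
    = pauli_sign s b' (maskB s W) * twirled s (bell_rel s (verticesB s) (linksB G y)) a' b' $$ (h, k)"
  proof -
    have "xor (xor k (maskB s W)) a' = xor (xor k a') (maskB s W)" by (simp add: ac_simps)
    thus ?thesis using less assms
      by (simp only: twirled_def index_mat prod.case linksB_flip pauli_sign_xor_right mult_ac)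
  qed
  show ?thesis unfolding branch_weight_def A B flow_phase_def by (simp only: mult_ac)
qed

end

section \<open>Amplitudes of the branches after the correction\<close>

lemma set_kron_lists: "set (kron_lists Ks Ls) = {kron K L | K L. K \<in> set Ks \<and> L \<in> set Ls}"
  by (auto simp: kron_lists_def)

text \<open>Flipping qubit \<open>k\<close> alone exchanges the two outputs and leaves the measured
  remainder \<open>c\<close> as it is. The sign is the phase correction, meant to cancel the phase
  in \<open>branch_weight_flip\<close>.\<close>

lemma readout_op_flip:
  assumes m: "\<And>j. bit m j \<longleftrightarrow> j = k" "m < 2 ^ N" and g: "g < 2 ^ N"
  shows "readout_op N k p z c $$ (1, xor g m) = (if z then - 1 else 1) * readout_op N k p z c $$ (0, g)"
proof -
  have "unset_bit k (xor g m) = unset_bit k g"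
    by (rule bit_eqI) (auto simp: bit_unset_bit_iff bit_xor_iff m(1))
  moreover have "bit (xor g m) k \<longleftrightarrow> \<not> bit g k" by (simp add: bit_xor_iff m(1))
  ultimately show ?thesis
    using xor_less_exp[OF g m(2)] g by (simp add: readout_op_def)
qed

lemma readout_op_nonzero:
  assumes "readout_op N k p z c $$ (i, g) \<noteq> 0" "i < 2" "g < 2 ^ N"
  shows "bit g k \<longleftrightarrow> (i = 1) \<noteq> p"
  using assms by (auto simp: readout_op_def split: if_splits)

locale hose_run = water_flow n G x y "water_path G x y" m for n G x y m
begin

abbreviation P where "P \<equiv> hose_attack n G"
abbreviation p where "p \<equiv> water_path G x y"
abbreviation amp where "amp \<equiv> amplitude (($) (epr_vec s)) (2 ^ s * 2 ^ s)"

definition opA where "opA a b a' b' c =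
  readout_op (Suc s) (vertex_pos s e) (flow_sign s W a a' = - 1) (flow_phase s W b b' = - 1) c"

definition opB where "opB a b a' b' c =
  readout_op s (vertex_pos s e) (flow_sign s W a a' = - 1) (flow_phase s W b b' = - 1) c"

definition branch_amp where "branch_amp a b a' b' c c' i i' q =
  (\<Sum>g<2 ^ Suc s. \<Sum>h<2 ^ s. \<Sum>k<2 ^ s.
    opA a b a' b' c $$ (i, g) * opB a b a' b' c' $$ (i', h) * branch_weight a b a' b' g h q k)"

text \<open>A branch contains an operator only if the messages name the true inputs, so both
  corrections refer to the actual water path.\<close>

lemma branch_amplitude:
  assumes "(Y, X) \<in> branches P x y"
  obtains a b a' b' c c' where
    "\<And>i i' q. i < 2 \<Longrightarrow> i' < 2 \<Longrightarrow> q < 2 \<Longrightarrow>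
      amp Y X (i * 2 + i') q = epr_pair $ 0 ^ s * branch_amp a b a' b' c c' i i' q"
proof -
  let ?RA = "\<lambda>x. bell_rel s (verticesA0 s) (linksA G x)"
  let ?RB = "\<lambda>y. bell_rel s (verticesB s) (linksB G y)"
  obtain \<mu> \<nu> K K' L L' where
    X: "X = kron K K'" "K \<in> set (twirl_instrument n (Suc s) ?RA x \<mu>)" "K' \<in> set (twirl_instrument n s ?RB y \<nu>)"
    and Y: "Y = kron L L'" "L \<in> set (correct G (Suc s) (decode n (Suc s) \<mu>) (decode n s \<nu>))"
      "L' \<in> set (correct G s (decode n (Suc s) \<mu>) (decode n s \<nu>))"
    using assms by (auto simp: branches_def hose_attack_def Let_def set_kron_lists)
  obtain x' a b y' a' b' where dec: "decode n (Suc s) \<mu> = (x', a, b)" "decode n s \<nu> = (y', a', b')"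
    by (metis prod_cases3)
  have \<mu>: "decode n (Suc s) \<mu> = (x, a, b)" and K: "K = twirled (Suc s) (?RA x) a b"
    using X(2) by (auto simp: twirl_instrument_def dec split: if_splits)
  have \<nu>: "decode n s \<nu> = (y, a', b')" and K': "K' = twirled s (?RB y) a' b'"
    using X(3) by (auto simp: twirl_instrument_def dec split: if_splits)
  obtain c c' where L: "L = opA a b a' b' c" and L': "L' = opB a b a' b' c'"
    using Y(2,3) unfolding \<mu> \<nu> correct_def by (auto simp: readout_def opA_def opB_def Let_def)
  have "amp Y X (i * 2 + i') q = epr_pair $ 0 ^ s * branch_amp a b a' b' c c' i i' q"
    if "i < 2" "i' < 2" "q < 2" for i i' q
    unfolding X(1) Y(1) K K' L L'
    using amplitude_epr[OF twirled_carrier[of "Suc s" "?RA x" a b] twirled_carrier[of s "?RB y" a' b']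
        readout_op_carrier readout_op_carrier that,
        of "vertex_pos s e" "flow_sign s W a a' = - 1" "flow_phase s W b b' = - 1" c
          "vertex_pos s e" "flow_sign s W a a' = - 1" "flow_phase s W b b' = - 1" c']
    by (simp only: opA_def opB_def branch_amp_def branch_weight_def mult.assoc)
  thus ?thesis by (rule that)
qed

lemma flow_phase_sign: "(if flow_phase s W b b' = - 1 then - 1 else 1) = flow_phase s W b b'"
  unfolding flow_phase_def using pauli_sign_cases[of "Suc s" b "maskA s W"] pauli_sign_cases[of s b' "maskB s W"]
  by (elim disjE) simp_all

lemma flow_phase_square: "flow_phase s W b b' * flow_phase s W b b' = 1"
  unfolding flow_phase_def using pauli_sign_cases[of "Suc s" b "maskA s W"] pauli_sign_cases[of s b' "maskB s W"]
  by (elim disjE) simp_all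

text \<open>Flipping \<open>g\<close>, \<open>h\<close> and \<open>k\<close> by fixed masks permutes
  the summands. The phase occurs twice, once from the weight and once, by assumption, from the
  readout, and it squares to 1.\<close>

lemma branch_amp_flip:
  assumes "\<And>g h. g < 2 ^ Suc s \<Longrightarrow> h < 2 ^ s \<Longrightarrow>
      opA a b a' b' c $$ (i, xor g (maskA s {e})) * opB a b a' b' c' $$ (i', xor h (maskB s {e})) =
      flow_phase s W b b' * (opA a b a' b' c $$ (j, g) * opB a b a' b' c' $$ (j', h))"
  shows "branch_amp a b a' b' c c' i i' 1 = branch_amp a b a' b' c c' j j' 0"
proof -
  let ?F = "\<lambda>g h k. opA a b a' b' c $$ (i, g) * opB a b a' b' c' $$ (i', h) * branch_weight a b a' b' g h 1 k"
  have "branch_amp a b a' b' c c' i i' 1 =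
    (\<Sum>g<2 ^ Suc s. \<Sum>h<2 ^ s. \<Sum>k<2 ^ s. ?F (xor g (maskA s {e})) h k)"
    unfolding branch_amp_def by (rule sum_xor_shift[OF maskA_less, symmetric])
  also have "\<dots> = (\<Sum>g<2 ^ Suc s. \<Sum>h<2 ^ s. \<Sum>k<2 ^ s. ?F (xor g (maskA s {e})) (xor h (maskB s {e})) k)"
    by (rule sum.cong[OF refl]) (rule sum_xor_shift[OF maskB_less, symmetric])
  also have "\<dots> = (\<Sum>g<2 ^ Suc s. \<Sum>h<2 ^ s. \<Sum>k<2 ^ s.
      ?F (xor g (maskA s {e})) (xor h (maskB s {e})) (xor k (maskB s W)))"
    by (rule sum.cong[OF refl], rule sum.cong[OF refl]) (rule sum_xor_shift[OF maskB_less, symmetric])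
  also have "\<dots> = branch_amp a b a' b' c c' j j' 0"
    unfolding branch_amp_def
  proof (intro sum.cong refl)
    fix g h k :: nat assume "g \<in> {..<2 ^ Suc s}" "h \<in> {..<2 ^ s}" "k \<in> {..<2 ^ s}"
    hence less: "g < 2 ^ Suc s" "h < 2 ^ s" "k < 2 ^ s" by auto
    show "?F (xor g (maskA s {e})) (xor h (maskB s {e})) (xor k (maskB s W)) =
      opA a b a' b' c $$ (j, g) * opB a b a' b' c' $$ (j', h) * branch_weight a b a' b' g h 0 k"
      unfolding assms[OF less(1,2)] branch_weight_flip[OF less]
      using flow_phase_square[of b b'] by (simp add: mult_ac)
  qed
  finally show ?thesis .
qed

lemma mask_other:
  "e \<in> verticesA0 s \<Longrightarrow> maskB s {e} = 0" "e \<in> verticesB s \<Longrightarrow> maskA s {e} = 0"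
  by (rule bit_eqI, auto simp: bit_maskA_iff bit_maskB_iff verticesA0_def verticesA_def verticesB_def)+

lemma bit_mask_end:
  "e \<in> verticesA0 s \<Longrightarrow> bit (maskA s {e}) j \<longleftrightarrow> j = vertex_pos s e"
  "e \<in> verticesB s \<Longrightarrow> bit (maskB s {e}) j \<longleftrightarrow> j = vertex_pos s e"
  by (auto simp: bit_maskA_iff bit_maskB_iff verticesA0_def verticesA_def verticesB_def vertex_pos_def
      split: if_splits)

text \<open>In a nonzero term the bit at the end is \<open>q\<close> plus the total shift, while the
  readout with output \<open>i\<close> demands \<open>i\<close> plus the total shift. For the second
  claim only Alice's readout sees the flip, because Bob's mask of the end is 0.\<close>

lemma Alice_amplitudes:
  assumes e: "e \<in> verticesA0 s" and YX: "(Y, X) \<in> branches P x y"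
  shows "i < 2 \<Longrightarrow> i' < 2 \<Longrightarrow> q < 2 \<Longrightarrow> q \<noteq> i \<Longrightarrow> amp Y X (i * 2 + i') q = 0"
    and "i' < 2 \<Longrightarrow> amp Y X (1 * 2 + i') 1 = amp Y X (0 * 2 + i') 0"
proof -
  obtain a b a' b' c c' where amp: "\<And>i i' q. i < 2 \<Longrightarrow> i' < 2 \<Longrightarrow> q < 2 \<Longrightarrow>
      amp Y X (i * 2 + i') q = epr_pair $ 0 ^ s * branch_amp a b a' b' c c' i i' q"
    using branch_amplitude[OF YX] by blast
  show "amp Y X (i * 2 + i') q = 0" if i: "i < 2" "i' < 2" "q < 2" "q \<noteq> i"
  proof -
    have "opA a b a' b' c $$ (i, g) * opB a b a' b' c' $$ (i', h) * branch_weight a b a' b' g h q k = 0"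
      if less: "g < 2 ^ Suc s" "h < 2 ^ s" "k < 2 ^ s" for g h k
    proof (rule ccontr)
      assume nz: "opA a b a' b' c $$ (i, g) * opB a b a' b' c' $$ (i', h) * branch_weight a b a' b' g h q k \<noteq> 0"
      hence nz: "opA a b a' b' c $$ (i, g) \<noteq> 0" "branch_weight a b a' b' g h q k \<noteq> 0" by auto
      have "(i = 1) = (q = 1)"
        using branch_weight_flow[OF nz(2) less i(3)] readout_op_nonzero[OF nz(1)[unfolded opA_def] i(1) less(1)]
        unfolding vertex_bit_A[OF e] by blast
      thus False using i by (auto simp: less_2_cases_iff)
    qed
    hence "branch_amp a b a' b' c c' i i' q = 0"
      unfolding branch_amp_def by (intro sum.neutral ballI) simp
    thus ?thesis using amp[OF i(1-3)] by simp
  qed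
  show "amp Y X (1 * 2 + i') 1 = amp Y X (0 * 2 + i') 0" if i': "i' < 2"
  proof -
    have "branch_amp a b a' b' c c' 1 i' 1 = branch_amp a b a' b' c c' 0 i' 0"
      by (rule branch_amp_flip)
        (simp only: mask_other(1)[OF e] xor.right_neutral opA_def mult.assoc flow_phase_sign
          readout_op_flip[OF bit_mask_end(1)[OF e] maskA_less])
    thus ?thesis using amp[of 1 i' 1] amp[of 0 i' 0] i' by simp
  qed
qed

lemma Bob_amplitudes:
  assumes e: "e \<in> verticesB s" and YX: "(Y, X) \<in> branches P x y"
  shows "i < 2 \<Longrightarrow> i' < 2 \<Longrightarrow> q < 2 \<Longrightarrow> q \<noteq> i' \<Longrightarrow> amp Y X (i * 2 + i') q = 0"
    and "i < 2 \<Longrightarrow> amp Y X (i * 2 + 1) 1 = amp Y X (i * 2 + 0) 0"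
proof -
  obtain a b a' b' c c' where amp: "\<And>i i' q. i < 2 \<Longrightarrow> i' < 2 \<Longrightarrow> q < 2 \<Longrightarrow>
      amp Y X (i * 2 + i') q = epr_pair $ 0 ^ s * branch_amp a b a' b' c c' i i' q"
    using branch_amplitude[OF YX] by blast
  show "amp Y X (i * 2 + i') q = 0" if i: "i < 2" "i' < 2" "q < 2" "q \<noteq> i'"
  proof -
    have "opA a b a' b' c $$ (i, g) * opB a b a' b' c' $$ (i', h) * branch_weight a b a' b' g h q k = 0"
      if less: "g < 2 ^ Suc s" "h < 2 ^ s" "k < 2 ^ s" for g h k
    proof (rule ccontr)
      assume nz: "opA a b a' b' c $$ (i, g) * opB a b a' b' c' $$ (i', h) * branch_weight a b a' b' g h q k \<noteq> 0"
      hence nz: "opB a b a' b' c' $$ (i', h) \<noteq> 0" "branch_weight a b a' b' g h q k \<noteq> 0" by auto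
      have "(i' = 1) = (q = 1)"
        using branch_weight_flow[OF nz(2) less i(3)] readout_op_nonzero[OF nz(1)[unfolded opB_def] i(2) less(2)]
        unfolding vertex_bit_B[OF e] by blast
      thus False using i by (auto simp: less_2_cases_iff)
    qed
    hence "branch_amp a b a' b' c c' i i' q = 0"
      unfolding branch_amp_def by (intro sum.neutral ballI) simp
    thus ?thesis using amp[OF i(1-3)] by simp
  qed
  show "amp Y X (i * 2 + 1) 1 = amp Y X (i * 2 + 0) 0" if i: "i < 2"
  proof -
    have "branch_amp a b a' b' c c' i 1 1 = branch_amp a b a' b' c c' i 0 0"
      by (rule branch_amp_flip)
        (simp only: mask_other(2)[OF e] xor.right_neutral opB_def mult.left_commute flow_phase_sign
          readout_op_flip[OF bit_mask_end(2)[OF e] maskB_less])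
    thus ?thesis using amp[of i 1 1] amp[of i 0 0] i by simp
  qed
qed

lemma Alice_receives:
  assumes e: "e \<in> verticesA0 s" and \<rho>: "\<rho> \<in> carrier_mat (r * 2) (r * 2)"
  shows "partial_trace (r * 2) 2 1 (final_state P x y r \<rho>) = \<rho>"
proof (rule eq_matI)
  interpret pure_attack n P "($) (epr_vec s)" "2 ^ s * 2 ^ s" x y
    by (rule pure_attack_hose[OF x y])
  fix i j assume "i < dim_row \<rho>" "j < dim_col \<rho>"
  hence ij: "i < r * 2" "j < r * 2" using \<rho> by auto
  obtain R h where i: "R < r" "h < 2" "i = R * 2 + h" by (rule less_mult_obtain[OF ij(1)])
  obtain R' h' where j: "R' < r" "h' < 2" "j = R' * 2 + h'" by (rule less_mult_obtain[OF ij(2)])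
  have "partial_trace (r * 2) 2 1 (final_state P x y r \<rho>) $$ (i, j) =
      (\<Sum>g<2. final_state P x y r \<rho> $$ (R * 4 + (h * 2 + g), R' * 4 + (h' * 2 + g)))"
    using ij by (simp add: partial_trace_def i(3) j(3) algebra_simps)
  also have "\<dots> = \<rho> $$ (R * 2 + h, R' * 2 + h')"
  proof (rule holder_marginal[OF epr_vec_norm \<rho> i(1) j(1) i(2) j(2), where pos = "\<lambda>h g. h * 2 + g"])
    show "(\<Sum>i<2 * 2. F i) = (\<Sum>h<2. \<Sum>g<2. F (h * 2 + g))" for F :: "nat \<Rightarrow> complex"
      by (rule sum_lessThan_mult_split)
    show "amp Y X (h * 2 + g) q = 0"
      if "(Y, X) \<in> branches P x y" "h < 2" "g < 2" "q < 2" "q \<noteq> h" for Y X h g q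
      using that by (rule Alice_amplitudes(1)[OF e])
    show "amp Y X (1 * 2 + g) 1 = amp Y X (0 * 2 + g) 0" if "(Y, X) \<in> branches P x y" "g < 2" for Y X g
      using that by (rule Alice_amplitudes(2)[OF e])
  qed simp
  finally show "partial_trace (r * 2) 2 1 (final_state P x y r \<rho>) $$ (i, j) = \<rho> $$ (i, j)"
    by (simp only: i(3) j(3))
qed (use \<rho> in \<open>auto simp: partial_trace_def\<close>)

lemma Bob_receives:
  assumes e: "e \<in> verticesB s" and \<rho>: "\<rho> \<in> carrier_mat (r * 2) (r * 2)"
  shows "partial_trace r 2 2 (final_state P x y r \<rho>) = \<rho>"
proof (rule eq_matI)
  interpret pure_attack n P "($) (epr_vec s)" "2 ^ s * 2 ^ s" x y
    by (rule pure_attack_hose[OF x y])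
  fix i j assume "i < dim_row \<rho>" "j < dim_col \<rho>"
  hence ij: "i < r * 2" "j < r * 2" using \<rho> by auto
  obtain R h where i: "R < r" "h < 2" "i = R * 2 + h" by (rule less_mult_obtain[OF ij(1)])
  obtain R' h' where j: "R' < r" "h' < 2" "j = R' * 2 + h'" by (rule less_mult_obtain[OF ij(2)])
  have "(R * 2 + g) * 2 + h = R * 4 + (g * 2 + h)" for R g h :: nat by simp
  hence "partial_trace r 2 2 (final_state P x y r \<rho>) $$ (i, j) =
      (\<Sum>g<2. final_state P x y r \<rho> $$ (R * 4 + (g * 2 + h), R' * 4 + (g * 2 + h')))"
    using ij i(2) j(2) by (simp add: partial_trace_def i(3) j(3) algebra_simps)
  also have "\<dots> = \<rho> $$ (R * 2 + h, R' * 2 + h')"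
  proof (rule holder_marginal[OF epr_vec_norm \<rho> i(1) j(1) i(2) j(2), where pos = "\<lambda>h g. g * 2 + h"])
    show "(\<Sum>i<2 * 2. F i) = (\<Sum>h<2. \<Sum>g<2. F (g * 2 + h))" for F :: "nat \<Rightarrow> complex"
      unfolding sum_lessThan_mult_split by (rule sum.swap)
    show "amp Y X (g * 2 + h) q = 0"
      if "(Y, X) \<in> branches P x y" "h < 2" "g < 2" "q < 2" "q \<noteq> h" for Y X h g q
      using that by (intro Bob_amplitudes(1)[OF e])
    show "amp Y X (g * 2 + 1) 1 = amp Y X (g * 2 + 0) 0" if "(Y, X) \<in> branches P x y" "g < 2" for Y X g
      using that by (rule Bob_amplitudes(2)[OF e])
  qed simp
  finally show "partial_trace r 2 2 (final_state P x y r \<rho>) $$ (i, j) = \<rho> $$ (i, j)"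
    by (simp only: i(3) j(3))
qed (use \<rho> in \<open>auto simp: partial_trace_def\<close>)

end

theorem perfect_hose_attack:
  assumes G: "garden_hose_game n G" and f: "computes n G f"
  shows "perfect_attack n f (hose_attack n G)"
  unfolding perfect_attack_def
proof (intro conjI ballI allI impI)
  fix x y r \<rho>
  assume xy: "x \<in> bitstrings n" "y \<in> bitstrings n" and "density_operator (r * 2) \<rho>"
  hence \<rho>: "\<rho> \<in> carrier_mat (r * 2) (r * 2)" by (simp add: density_operator_def)
  obtain m where "water_flow n G x y (water_path G x y) m"
    using water_path_flow[OF G xy] by blast
  then interpret hose_run n G x y m by (simp add: hose_run_def)
  show "partial_trace (r * 2) 2 1 (final_state (hose_attack n G) x y r \<rho>) = \<rho>" if "\<not> f x y"
    using Alice_receives[OF _ \<rho>] f that xy by (simp add: computes_def)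
  show "partial_trace r 2 2 (final_state (hose_attack n G) x y r \<rho>) = \<rho>" if "f x y"
    using Bob_receives[OF _ \<rho>] f that xy by (simp add: computes_def)
qed (rule valid_hose_attack)

section \<open>Every function has a garden-hose game\<close>

lemma water_path_eqI:
  assumes G: "garden_hose_game n G" "x \<in> bitstrings n" "y \<in> bitstrings n"
    and p: "graph_path (game_vertices G) (game_edges G x y) p" "hd p = Tap"
    and stuck: "\<And>v. {last p, v} \<in> game_edges G x y \<Longrightarrow> v \<in> set p"
  shows "water_path G x y = p"
proof -
  have "\<not> graph_path (game_vertices G) (game_edges G x y) (p @ q)" if "q \<noteq> []" for q
  proof
    assume *: "graph_path (game_vertices G) (game_edges G x y) (p @ q)"
    obtain v q' where q: "q = v # q'" using \<open>q \<noteq> []\<close> by (cases q) auto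
    have "p \<noteq> []" using p by (simp add: graph_path_def)
    with * have "{last p, v} \<in> game_edges G x y" "v \<notin> set p"
      by (auto simp: graph_path_def q successively_append_iff)
    thus False using stuck by blast
  qed
  hence "maximal_path_from (game_vertices G) (game_edges G x y) Tap p"
    using p by (simp add: maximal_path_from_def)
  thus ?thesis unfolding water_path_def using water_path_unique[OF G] by (rule the1_equality[rotated])
qed

text \<open>Alice leads the tap into the pipe that encodes her input. Bob either leaves that pipe open or
  returns the water through one of \<open>card (bitstrings n)\<close> additional pipes.\<close>

lemma garden_hose_game_exists: "\<exists>G. garden_hose_game n G \<and> computes n G f"
proof -
  let ?N = "card (bitstrings n)"
  obtain h where h: "bij_betw h (bitstrings n) {0..<?N}"
    using ex_bij_betw_finite_nat[OF finite_bitstrings] by blast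
  define c where "c x = Suc (h x)" for x
  have c_range: "1 \<le> c x" "c x \<le> ?N" if "x \<in> bitstrings n" for x
    using bij_betwE[OF h] that by (auto simp: c_def Suc_le_eq)
  have c_inj: "c x = c x' \<longleftrightarrow> x = x'" if "x \<in> bitstrings n" "x' \<in> bitstrings n" for x x'
    using bij_betw_imp_inj_on[OF h] that by (auto simp: c_def inj_on_def)
  \<comment> \<open>The link with which Bob returns the water that arrives through pipe
    \<open>c x\<close>. Pipes up to \<open>?N\<close> carry the water to Bob, and each has its
    return pipe \<open>?N\<close> numbers higher.\<close>
  define ret where "ret x = {PipeB (c x), PipeB (c x + ?N)}" for x
  define G where "G = \<lparr> num_pipes = 2 * ?N, linksA = (\<lambda>x. {{Tap, PipeA (c x)}}),
    linksB = (\<lambda>y. ret ` {x \<in> bitstrings n. \<not> f x y}) \<rparr>"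
  have sel: "num_pipes G = 2 * ?N" "linksA G x = {{Tap, PipeA (c x)}}"
    "linksB G y = ret ` {x \<in> bitstrings n. \<not> f x y}" for x y by (simp_all add: G_def)
  have VA: "PipeA i \<in> verticesA0 (2 * ?N) \<longleftrightarrow> 1 \<le> i \<and> i \<le> 2 * ?N" "Tap \<in> verticesA0 (2 * ?N)" for i
    by (auto simp: verticesA0_def verticesA_def)
  have VB: "PipeB i \<in> verticesB (2 * ?N) \<longleftrightarrow> 1 \<le> i \<and> i \<le> 2 * ?N" for i
    by (auto simp: verticesB_def)
  have ret_inj: "x = x'" if "x \<in> bitstrings n" "x' \<in> bitstrings n" "v \<in> ret x" "v \<in> ret x'" for x x' v
  proof -
    \<comment> \<open>A return link has one end numbered at most \<open>?N\<close> and one above, so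
      a common vertex is the lower end of both or the higher end of both.\<close>
    have "c x = c x'" using that c_range[of x] c_range[of x'] by (auto simp: ret_def)
    thus ?thesis using c_inj that by blast
  qed
  have game: "garden_hose_game n G"
    unfolding garden_hose_game_def sel
  proof (intro conjI ballI)
    fix x v assume x: "x \<in> bitstrings n"
    have "{Tap, PipeA (c x)} \<in> {{u, v} | u v. u \<in> verticesA0 (2 * ?N) \<and> v \<in> verticesA0 (2 * ?N) \<and> u \<noteq> v}"
      using c_range[OF x] VA by (intro CollectI exI[of _ Tap] exI[of _ "PipeA (c x)"]) simp
    thus "graph_edges (verticesA0 (2 * ?N)) {{Tap, PipeA (c x)}}" by (simp only: graph_edges_def insert_subset empty_subsetI)
    have "degree_in {{Tap, PipeA (c x)}} v \<le> card {{Tap, PipeA (c x)}}"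
      unfolding degree_in_def by (intro card_mono) auto
    thus "degree_in {{Tap, PipeA (c x)}} v \<le> 1" by simp
  next
    fix y v assume y: "y \<in> bitstrings n"
    let ?E = "ret ` {x \<in> bitstrings n. \<not> f x y}"
    have "ret x \<in> {{u, v} | u v. u \<in> verticesB (2 * ?N) \<and> v \<in> verticesB (2 * ?N) \<and> u \<noteq> v}"
      if x: "x \<in> bitstrings n" for x
      using c_range[OF x] VB unfolding ret_def
      by (intro CollectI exI[of _ "PipeB (c x)"] exI[of _ "PipeB (c x + ?N)"]) simp
    thus "graph_edges (verticesB (2 * ?N)) ?E" by (auto simp: graph_edges_def simp del: mem_Collect_eq)
    have "e = e'" if ee: "e \<in> ?E" "e' \<in> ?E" "v \<in> e" "v \<in> e'" for e e'
    proof -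
      obtain x x' where "x \<in> bitstrings n" "x' \<in> bitstrings n" "e = ret x" "e' = ret x'"
        using ee(1,2) by blast
      thus ?thesis using ret_inj[of x x' v] ee by simp
    qed
    hence "card {e \<in> ?E. v \<in> e} \<le> Suc 0"
      using finite_bitstrings by (subst card_le_Suc0_iff_eq) auto
    thus "degree_in ?E v \<le> 1" by (simp add: degree_in_def)
  qed
  have edges: "{u, v} \<in> game_edges G x y \<longleftrightarrow>
      (\<exists>i. 1 \<le> i \<and> i \<le> 2 * ?N \<and> {u, v} = {PipeA i, PipeB i}) \<or> {u, v} = {Tap, PipeA (c x)} \<or>
      (\<exists>x'\<in>bitstrings n. \<not> f x' y \<and> {u, v} = {PipeB (c x'), PipeB (c x' + ?N)})" for u v x y
    by (auto simp: game_edges_def sel pipes_def ret_def)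
  have "computes n G f"
    unfolding computes_def
  proof (intro ballI conjI impI)
    fix x y assume xy: "x \<in> bitstrings n" "y \<in> bitstrings n"
    note cx = c_range[OF xy(1)]
    {
      assume f: "f x y"
      let ?p = "[Tap, PipeA (c x), PipeB (c x)]"
      have "water_path G x y = ?p"
      proof (rule water_path_eqI[OF game xy])
        show "graph_path (game_vertices G) (game_edges G x y) ?p"
          using cx by (auto simp: graph_path_def game_vertices_def sel VA VB edges doubleton_eq_iff)
        fix v assume "{last ?p, v} \<in> game_edges G x y"
        \<comment> \<open>As \<open>f x y\<close> holds, pipe \<open>c x\<close> has no return link:
          injectivity of \<open>c\<close> excludes the lower ends of the links for other inputs, and
          the bound \<open>?N\<close> excludes the higher ends.\<close>
        moreover have "c x \<noteq> c x'" "c x \<noteq> c x' + ?N" if "x' \<in> bitstrings n" "\<not> f x' y" for x'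
          using that f c_inj[OF xy(1), of x'] cx c_range[of x'] by auto
        ultimately show "v \<in> set ?p" by (auto simp: edges doubleton_eq_iff)
      qed simp
      thus "last (water_path G x y) \<in> verticesB (num_pipes G)" using cx by (simp add: sel VB)
    next
      assume f: "\<not> f x y"
      let ?p = "[Tap, PipeA (c x), PipeB (c x), PipeB (c x + ?N), PipeA (c x + ?N)]"
      have "water_path G x y = ?p"
      proof (rule water_path_eqI[OF game xy])
        have "\<exists>x'\<in>bitstrings n. \<not> f x' y \<and> c x = c x'" using f xy by blast
        thus "graph_path (game_vertices G) (game_edges G x y) ?p"
          using cx by (auto simp: graph_path_def game_vertices_def sel VA VB edges doubleton_eq_iff)
        fix v assume "{last ?p, v} \<in> game_edges G x y"
        thus "v \<in> set ?p" using cx by (auto simp: edges doubleton_eq_iff)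
      qed simp
      thus "last (water_path G x y) \<in> verticesA0 (num_pipes G)" using cx by (simp add: sel VA)
    }
  qed
  with game show ?thesis by blast
qed

theorem mainTheorem3:
  fixes n :: nat and f :: "bool list \<Rightarrow> bool list \<Rightarrow> bool"
  shows "(\<forall>s G. garden_hose_game n G \<and> num_pipes G = s \<and> computes n G f \<longrightarrow>
            (\<exists>P. shares_epr_pairs s P \<and> perfect_attack n f P))
       \<and> (\<exists>P. shares_epr_pairs (GH n f) P \<and> perfect_attack n f P)"
proof (intro conjI allI impI)
  fix s G
  assume "garden_hose_game n G \<and> num_pipes G = s \<and> computes n G f"
  thus "\<exists>P. shares_epr_pairs s P \<and> perfect_attack n f P"
    using shares_epr_pairs_hose_attack perfect_hose_attack by blast
next
  \<comment> \<open>\<open>GH\<close> is a \<open>LEAST\<close>, and a minimal game exists only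
    because the set of sizes is nonempty.\<close>
  have "\<exists>s G. garden_hose_game n G \<and> num_pipes G = s \<and> computes n G f"
    using garden_hose_game_exists by blast
  from LeastI_ex[OF this] obtain G where
    "garden_hose_game n G" "num_pipes G = GH n f" "computes n G f"
    unfolding GH_def by blast
  thus "\<exists>P. shares_epr_pairs (GH n f) P \<and> perfect_attack n f P"
    using shares_epr_pairs_hose_attack perfect_hose_attack by metis
qed

end
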